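(* Let $y:M\to Q^n_r$ be a spacelike isothermic surface and let $y^*=[Y^*]$ be a $D^\theta$-transform of $y$. If $\psi$ is a non-degenerate $c$-polar surface of $y$, then there exists a $c$-polar surface $\psi^*$ of $y^*$ such that $\psi^*$ is also a $D^\theta$-transform of $\psi$ (with the same parameter $\theta$).
   Context: **Ambient spaces.** $\mathbb{R}^m_s$ is $\mathbb{R}^m$ with $\langle x,x\rangle=\sum_{i=1}^{m-s}x_i^2-\sum_{i=m-s+1}^m x_i^2$, extended complex bilinearly. Let $n-r\ge2$, $r\ge0$. $Q^n_r\subset\mathbb{R}P^{n+1}$ is the set of null lines in $\mathbb{R}^{n+2}_{r+1}$, with its standard conformal structure of signature $(n-r,r)$. **Conformal invariants.** Let $y:M\to Q^n_r$ be a spacelike surface (conformal immersion inducing a positive definite conformal class) with local complex coordinate $z$. The canonical lift $Y$ is the local lift of $y$ into the light cone minus $0$ with $|dY|^2=|dz|^2$. Put $V=\mathrm{Span}\{Y,\mathrm{Re}\,Y_z,\mathrm{Im}\,Y_z,Y_{z\bar z}\}$. The conformal normal bundle $V^\perp$ is its orthogonal complement, with induced connection $D$. The Schwarzian $s$ and the conformal Hopf differential $\kappa\in\Gamma(V^\perp\otimes\mathbb{C})$ are defined by $Y_{zz}=-\frac s2Y+\kappa$. The surface is isothermic if around each point there is a complex coordinate $z$ (adapted coordinate) for which $\kappa$ is real-valued. **$c$-polar transforms.** Let $y$ be spacelike isothermic, and let $\psi\in\Gamma(V^\perp)$ be a real, nonzero section with $D_z\psi=0$ and $\langle\psi,\psi\rangle=c$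 constant. If $c\ne0$, $\psi:M\to N_c=\{x\in\mathbb{R}^{n+2}_{r+1}\mid\langle x,x\rangle=c\}$ is a $c$-polar transform (or $c$-polar surface) of $y$. If $c=0$, $[\psi]:M\to Q^n_r$ is a $0$-polar transform of $y$. It is non-degenerate if $\psi$ is an immersion with positive definite induced metric; equivalently, $\langle\psi,\kappa\rangle\neq0$ everywhere. **Darboux transform.** Let $y$ be a spacelike isothermic surface with adapted coordinate $z$ and canonical lift $Y$. A spacelike immersion $y^*:M\to Q^n_r$ is a Darboux transform of $y$ if its local lift $Y^*$ satisfies $\langle Y,Y^*\rangle\neq0$ and $Y^*_z\in\mathrm{Span}_{\mathbb{C}}\{Y^*,Y,Y_{\bar z}\}$. In that case (known fact) $y^*$ is isothermic with the same adapted coordinate $z$, and, normalizing $\langle Y,Y^*\rangle=-1$, one has $Y^*_z=\frac\mu2Y^*+\theta\big(Y_{\bar z}+\frac{\bar\mu}2Y\big)$ for some complex function $\mu$ and some non-zero real constant $\theta$. It is then called a $D^\theta$-transform of $y$ (with respect to $z$). **Darboux transforms of polar surfaces.** For $c\neq0$, Darboux transforms of surfaces in $N_c$ are understood by viewing $\psi:M\to N_c$ as the surface $[(\psi,\sqrt{|c|})]$ in the projectivized light cone of $\mathbb{R}^{n+2}_{r+1}\oplus\mathbb{R}$ with inner product $\langle x,x\rangle-\mathrm{sgn}(c)\,t^2$ (the conformal embedding of $N_c$ into its conformal compactification). For $c=0$, they are those of $[\psi]$ in $Q^n_r$. The parameter $\theta$ of all Darboux transforms refers to the same adapted coordinate 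$z$.
   Formalization: The c-polar surface ψ* of y* exists on all of M, but it is claimed to be a D^θ-transform of ψ only at the points where ψ is not orthogonal to Y*; elsewhere the claim can fail, e.g. when y* lies in a round 2-sphere in S^3 and every 1-polar surface of y* is constant. *)

theory Defs
  imports "HOL-Analysis.Analysis"
begin

section \<open>Pseudo-Euclidean space and its complexification\<close>

text \<open>
  The space of signature (m - s, s) is \<^typ>\<open>real^'m\<close> with a set \<open>N\<close> of s coordinates that carry
  the minus sign. At type \<^typ>\<open>complex^'m\<close> the same formula is the complex bilinear (not
  Hermitian) extension.
\<close>

definition sig_inner :: "'m::finite set \<Rightarrow> 'b::comm_ring_1 ^ 'm \<Rightarrow> 'b ^ 'm \<Rightarrow> 'b" where
  "sig_inner N x y = (\<Sum>i\<in>-N. x $ i * y $ i) - (\<Sum>i\<in>N. x $ i * y $ i)"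

definition cvec :: "real ^ 'm \<Rightarrow> complex ^ 'm" where
  "cvec x = (\<chi> i. complex_of_real (x $ i))"

definition Re_vec :: "complex ^ 'm \<Rightarrow> real ^ 'm" where
  "Re_vec x = (\<chi> i. Re (x $ i))"

definition Im_vec :: "complex ^ 'm \<Rightarrow> real ^ 'm" where
  "Im_vec x = (\<chi> i. Im (x $ i))"

definition complexify :: "(real ^ 'm::finite) set \<Rightarrow> (complex ^ 'm) set" where
  "complexify S = vec.span (cvec ` S)"

definition light_cone :: "'m::finite set \<Rightarrow> (real ^ 'm) set" where
  "light_cone N = {x. sig_inner N x x = 0}"

text \<open>Points of projective space are one-dimensional subspaces.\<close>

definition null_quadric :: "'m::finite set \<Rightarrow> (real ^ 'm) set set" where
  "null_quadric N = (\<lambda>x. span {x}) ` (light_cone N - {0})"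


section \<open>Calculus on a coordinate domain\<close>

text \<open>
  In this and the next two sections a surface is written in a complex coordinate: \<open>D\<close> is the open
  image of the coordinate and maps are functions of the coordinate value.
\<close>

primrec Ck_on :: "nat \<Rightarrow> complex set \<Rightarrow> (complex \<Rightarrow> 'b::real_normed_vector) \<Rightarrow> bool" where
  "Ck_on 0 D f \<longleftrightarrow> continuous_on D f"
| "Ck_on (Suc k) D f \<longleftrightarrow>
     (\<forall>p\<in>D. f differentiable (at p)) \<and> (\<forall>v. Ck_on k D (\<lambda>p. frechet_derivative f (at p) v))"

definition smooth_on :: "complex set \<Rightarrow> (complex \<Rightarrow> 'b::real_normed_vector) \<Rightarrow> bool" where
  "smooth_on D f \<longleftrightarrow> (\<forall>k. Ck_on k D f)"

definition d_z :: "(complex \<Rightarrow> complex ^ 'm::finite) \<Rightarrow> complex \<Rightarrow> complex ^ 'm" where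
  "d_z F p = (1/2) *s (frechet_derivative F (at p) 1 - \<i> *s frechet_derivative F (at p) \<i>)"

definition d_zbar :: "(complex \<Rightarrow> complex ^ 'm::finite) \<Rightarrow> complex \<Rightarrow> complex ^ 'm" where
  "d_zbar F p = (1/2) *s (frechet_derivative F (at p) 1 + \<i> *s frechet_derivative F (at p) \<i>)"

abbreviation cfun :: "(complex \<Rightarrow> real ^ 'm) \<Rightarrow> complex \<Rightarrow> complex ^ 'm" where
  "cfun f \<equiv> (\<lambda>p. cvec (f p))"

definition induced_metric ::
  "'m::finite set \<Rightarrow> (complex \<Rightarrow> real ^ 'm) \<Rightarrow> complex \<Rightarrow> complex \<Rightarrow> real" where
  "induced_metric N f p v =
     sig_inner N (frechet_derivative f (at p) v) (frechet_derivative f (at p) v)"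

definition nondegenerate_on :: "'m::finite set \<Rightarrow> complex set \<Rightarrow> (complex \<Rightarrow> real ^ 'm) \<Rightarrow> bool" where
  "nondegenerate_on N D f \<longleftrightarrow> (\<forall>p\<in>D. \<forall>v. v \<noteq> 0 \<longrightarrow> induced_metric N f p v > 0)"


section \<open>Spacelike surfaces and their conformal invariants\<close>

definition lift_on ::
  "'m::finite set \<Rightarrow> complex set \<Rightarrow> (complex \<Rightarrow> (real ^ 'm) set) \<Rightarrow> (complex \<Rightarrow> real ^ 'm) \<Rightarrow> bool" where
  "lift_on N W y L \<longleftrightarrow>
     smooth_on W L \<and> (\<forall>p\<in>W. L p \<in> light_cone N - {0} \<and> y p = span {L p})"

text \<open>
  The coordinate is a conformal coordinate of the surface: the metric induced by a local lift is a
  positive multiple of the flat metric. This does not depend on the lift.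
\<close>

definition spacelike_on ::
  "'m::finite set \<Rightarrow> complex set \<Rightarrow> (complex \<Rightarrow> (real ^ 'm) set) \<Rightarrow> bool" where
  "spacelike_on N D y \<longleftrightarrow> y ` D \<subseteq> null_quadric N \<and>
     (\<forall>p\<in>D. \<exists>W L. open W \<and> p \<in> W \<and> W \<subseteq> D \<and> lift_on N W y L \<and>
        (\<forall>q\<in>W. \<exists>\<rho>>0. \<forall>v. induced_metric N L q v = \<rho> * (norm v)\<^sup>2))"

definition canonical_lift_on ::
  "'m::finite set \<Rightarrow> complex set \<Rightarrow> (complex \<Rightarrow> (real ^ 'm) set) \<Rightarrow> (complex \<Rightarrow> real ^ 'm) \<Rightarrow> bool" where
  "canonical_lift_on N W y Y \<longleftrightarrow>
     lift_on N W y Y \<and> (\<forall>p\<in>W. \<forall>v. induced_metric N Y p v = (norm v)\<^sup>2)"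

text \<open>
  A canonical lift is unique up to a locally constant sign. Everything below is invariant under
  this sign, so conditions on "the" local canonical lift are stated for some canonical lift around
  each point. In the next definition the fourth
  vector is real already; its real part is taken only to adjust the type.
\<close>

definition V_space :: "(complex \<Rightarrow> real ^ 'm::finite) \<Rightarrow> complex \<Rightarrow> (real ^ 'm) set" where
  "V_space Y p = span {Y p, Re_vec (d_z (cfun Y) p), Im_vec (d_z (cfun Y) p),
                       Re_vec (d_z (d_zbar (cfun Y)) p)}"

definition V_perp :: "'m::finite set \<Rightarrow> (complex \<Rightarrow> real ^ 'm) \<Rightarrow> complex \<Rightarrow> (real ^ 'm) set" where
  "V_perp N Y p = {x. \<forall>v\<in>V_space Y p. sig_inner N x v = 0}"

definition hopf_differential ::
  "'m::finite set \<Rightarrow> (complex \<Rightarrow> real ^ 'm) \<Rightarrow> complex \<Rightarrow> complex ^ 'm" where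
  "hopf_differential N Y p =
     (THE \<kappa>. \<kappa> \<in> complexify (V_perp N Y p) \<and>
        (\<exists>s. d_z (d_z (cfun Y)) p = - (s / 2) *s cvec (Y p) + \<kappa>))"

text \<open>\<open>normal_D_z\<close> is the component of the z-derivative of \<open>\<psi>\<close> in the complexified normal bundle.\<close>

definition normal_D_z ::
  "'m::finite set \<Rightarrow> (complex \<Rightarrow> real ^ 'm) \<Rightarrow> (complex \<Rightarrow> real ^ 'm) \<Rightarrow> complex \<Rightarrow> complex ^ 'm" where
  "normal_D_z N Y \<psi> p =
     (THE w. w \<in> complexify (V_perp N Y p) \<and> d_z (cfun \<psi>) p - w \<in> complexify (V_space Y p))"

text \<open>The surface is isothermic and the given coordinate is adapted.\<close>

definition isothermic_on ::
  "'m::finite set \<Rightarrow> complex set \<Rightarrow> (complex \<Rightarrow> (real ^ 'm) set) \<Rightarrow> bool" where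
  "isothermic_on N D y \<longleftrightarrow> spacelike_on N D y \<and>
     (\<forall>p\<in>D. \<exists>W Y. open W \<and> p \<in> W \<and> W \<subseteq> D \<and> canonical_lift_on N W y Y \<and>
        (\<forall>q\<in>W. hopf_differential N Y q \<in> range cvec))"


section \<open>Polar and Darboux transforms\<close>

definition c_polar_on ::
  "'m::finite set \<Rightarrow> complex set \<Rightarrow> real \<Rightarrow> (complex \<Rightarrow> (real ^ 'm) set) \<Rightarrow> (complex \<Rightarrow> real ^ 'm) \<Rightarrow> bool" where
  "c_polar_on N D c y \<psi> \<longleftrightarrow> isothermic_on N D y \<and> smooth_on D \<psi> \<and>
     (\<forall>p\<in>D. \<psi> p \<noteq> 0 \<and> sig_inner N (\<psi> p) (\<psi> p) = c) \<and>
     (\<forall>p\<in>D. \<exists>W Y. open W \<and> p \<in> W \<and> W \<subseteq> D \<and> canonical_lift_on N W y Y \<and>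
        (\<forall>q\<in>W. \<psi> q \<in> V_perp N Y q \<and> normal_D_z N Y \<psi> q = 0))"

definition darboux_transform_on ::
  "'m::finite set \<Rightarrow> complex set \<Rightarrow> (complex \<Rightarrow> (real ^ 'm) set) \<Rightarrow> (complex \<Rightarrow> (real ^ 'm) set) \<Rightarrow> bool" where
  "darboux_transform_on N D y ys \<longleftrightarrow> isothermic_on N D y \<and> spacelike_on N D ys \<and>
     (\<forall>p\<in>D. \<exists>W Y Ys. open W \<and> p \<in> W \<and> W \<subseteq> D \<and> canonical_lift_on N W y Y \<and> lift_on N W ys Ys \<and>
        (\<forall>q\<in>W. sig_inner N (Y q) (Ys q) \<noteq> 0 \<and>
           d_z (cfun Ys) q \<in> vec.span {cvec (Ys q), cvec (Y q), d_zbar (cfun Y) q}))"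

definition D_transform_on ::
  "'m::finite set \<Rightarrow> complex set \<Rightarrow> real \<Rightarrow> (complex \<Rightarrow> (real ^ 'm) set) \<Rightarrow> (complex \<Rightarrow> (real ^ 'm) set) \<Rightarrow> bool" where
  "D_transform_on N D \<theta> y ys \<longleftrightarrow> darboux_transform_on N D y ys \<and> \<theta> \<noteq> 0 \<and>
     (\<forall>p\<in>D. \<exists>W Y Ys \<mu>. open W \<and> p \<in> W \<and> W \<subseteq> D \<and> canonical_lift_on N W y Y \<and> lift_on N W ys Ys \<and>
        (\<forall>q\<in>W. sig_inner N (Y q) (Ys q) = - 1 \<and>
           d_z (cfun Ys) q = (\<mu> q / 2) *s cvec (Ys q) +
             complex_of_real \<theta> *s (d_zbar (cfun Y) q + (cnj (\<mu> q) / 2) *s cvec (Y q))))"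

text \<open>
  For \<open>c \<noteq> 0\<close> the hyperquadric of vectors of square \<open>c\<close> is embedded in the null quadric of the space
  with one more coordinate, which carries the sign of \<open>- c\<close>.
\<close>

definition ext_neg :: "'m set \<Rightarrow> real \<Rightarrow> 'm option set" where
  "ext_neg N c = Some ` N \<union> (if c > 0 then {None} else {})"

definition ext_vec :: "real \<Rightarrow> real ^ 'm \<Rightarrow> real ^ 'm option" where
  "ext_vec c x = (\<chi> i. case i of None \<Rightarrow> sqrt \<bar>c\<bar> | Some j \<Rightarrow> x $ j)"

definition polar_D_transform_on ::
  "'m::finite set \<Rightarrow> complex set \<Rightarrow> real \<Rightarrow> real \<Rightarrow> (complex \<Rightarrow> real ^ 'm) \<Rightarrow> (complex \<Rightarrow> real ^ 'm) \<Rightarrow> bool" where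
  "polar_D_transform_on N D c \<theta> \<psi> \<psi>s \<longleftrightarrow>
     (if c = 0 then D_transform_on N D \<theta> (\<lambda>p. span {\<psi> p}) (\<lambda>p. span {\<psi>s p})
      else D_transform_on (ext_neg N c) D \<theta>
             (\<lambda>p. span {ext_vec c (\<psi> p)}) (\<lambda>p. span {ext_vec c (\<psi>s p)}))"


section \<open>Surfaces with an atlas of coordinates\<close>

text \<open>
  A chart is a pair of its domain and the coordinate function. An atlas \<open>Z\<close> makes \<open>M\<close> a Riemann
  surface; the definitions below ask for the coordinate condition in every chart of \<open>Z\<close>. In
  particular \<open>isothermic Z y\<close> says that \<open>Z\<close> consists of adapted coordinates, and the parameter of
  \<open>D_transform\<close> refers to each of them. A single adapted coordinate z on \<open>M\<close> is \<open>Z = {(M, z)}\<close>.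
\<close>

type_synonym 'a atlas = "('a set \<times> ('a \<Rightarrow> complex)) set"

definition complex_atlas :: "'a::topological_space set \<Rightarrow> 'a atlas \<Rightarrow> bool" where
  "complex_atlas M Z \<longleftrightarrow>
     (\<Union>(U, z)\<in>Z. U) = M \<and>
     (\<forall>(U, z)\<in>Z. openin (top_of_set M) U \<and> open (z ` U) \<and>
        homeomorphism U (z ` U) z (inv_into U z)) \<and>
     (\<forall>(U, z)\<in>Z. \<forall>(U', z')\<in>Z. (\<lambda>w. z' (inv_into U z w)) holomorphic_on z ` (U \<inter> U'))"

definition restrict_atlas :: "'a atlas \<Rightarrow> 'a set \<Rightarrow> 'a atlas" where
  "restrict_atlas Z A = (\<lambda>(U, z). (U \<inter> A, z)) ` Z"

definition isothermic :: "'m::finite set \<Rightarrow> 'a atlas \<Rightarrow> ('a \<Rightarrow> (real ^ 'm) set) \<Rightarrow> bool" where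
  "isothermic N Z y \<longleftrightarrow> (\<forall>(U, z)\<in>Z. isothermic_on N (z ` U) (y \<circ> inv_into U z))"

definition D_transform ::
  "'m::finite set \<Rightarrow> 'a atlas \<Rightarrow> real \<Rightarrow> ('a \<Rightarrow> (real ^ 'm) set) \<Rightarrow> ('a \<Rightarrow> (real ^ 'm) set) \<Rightarrow> bool" where
  "D_transform N Z \<theta> y ys \<longleftrightarrow>
     (\<forall>(U, z)\<in>Z. D_transform_on N (z ` U) \<theta> (y \<circ> inv_into U z) (ys \<circ> inv_into U z))"

definition c_polar ::
  "'m::finite set \<Rightarrow> 'a atlas \<Rightarrow> real \<Rightarrow> ('a \<Rightarrow> (real ^ 'm) set) \<Rightarrow> ('a \<Rightarrow> real ^ 'm) \<Rightarrow> bool" where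
  "c_polar N Z c y \<psi> \<longleftrightarrow>
     (\<forall>(U, z)\<in>Z. c_polar_on N (z ` U) c (y \<circ> inv_into U z) (\<psi> \<circ> inv_into U z))"

definition nondegenerate :: "'m::finite set \<Rightarrow> 'a atlas \<Rightarrow> ('a \<Rightarrow> real ^ 'm) \<Rightarrow> bool" where
  "nondegenerate N Z \<psi> \<longleftrightarrow> (\<forall>(U, z)\<in>Z. nondegenerate_on N (z ` U) (\<psi> \<circ> inv_into U z))"

definition polar_D_transform ::
  "'m::finite set \<Rightarrow> 'a atlas \<Rightarrow> real \<Rightarrow> real \<Rightarrow> ('a \<Rightarrow> real ^ 'm) \<Rightarrow> ('a \<Rightarrow> real ^ 'm) \<Rightarrow> bool" where
  "polar_D_transform N Z c \<theta> \<psi> \<psi>s \<longleftrightarrow>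
     (\<forall>(U, z)\<in>Z. polar_D_transform_on N (z ` U) c \<theta> (\<psi> \<circ> inv_into U z) (\<psi>s \<circ> inv_into U z))"

text \<open>
  The points where the vector \<open>\<psi>\<close> is not orthogonal to the null line \<open>ys\<close>. A Darboux pair must have
  lifts with non-zero inner product; for \<open>\<psi>\<close> and the polar surface of \<open>ys\<close> associated with it this
  holds exactly at these points.
\<close>

definition nonorthogonal_set ::
  "'m::finite set \<Rightarrow> 'a set \<Rightarrow> ('a \<Rightarrow> real ^ 'm) \<Rightarrow> ('a \<Rightarrow> (real ^ 'm) set) \<Rightarrow> 'a set" where
  "nonorthogonal_set N M \<psi> ys = {p\<in>M. \<exists>v\<in>ys p. sig_inner N (\<psi> p) v \<noteq> 0}"

end

theory Submission
  imports Defs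
begin

text \<open>
  In real coordinates a canonical lift \<open>Y\<close> of an isothermic surface satisfies \<open>Y\<^sub>1\<^sub>2 = \<sigma> Y\<close>, and a
  \<open>D\<^sup>\<theta>\<close>-transform \<open>Z\<close>, normalised by \<open>\<langle>Y, Z\<rangle> = -1\<close>, satisfies
  \<open>Z\<^sub>1 = a Z + \<theta> (Y\<^sub>1 + a Y)\<close> and \<open>Z\<^sub>2 = b Z - \<theta> (Y\<^sub>2 + b Y)\<close>. A \<open>c\<close>-polar surface \<open>\<psi>\<close> satisfies
  \<open>\<psi>\<^sub>1 = k\<^sub>1 Y - k Y\<^sub>1\<close> and \<open>\<psi>\<^sub>2 = k Y\<^sub>2 - k\<^sub>2 Y\<close> with \<open>k = \<langle>\<psi>, Y\<^sub>1\<^sub>1\<rangle> = 2 \<langle>\<psi>, \<kappa>\<rangle>\<close>. The transformed polar surface is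
  \<open>\<psi> + g Y + (k / \<theta>) Z\<close> with \<open>g = \<langle>\<psi>, Z\<rangle>\<close>: the coefficient of \<open>Y\<close> makes it orthogonal to \<open>Z\<close>, and
  the coefficient of \<open>Z\<close> cancels the \<open>Y\<^sub>1\<close>-term that \<open>\<psi>\<^sub>1\<close> contributes to its derivative. Normalised lifts of
  the new Darboux pair are \<open>\<psi> / k\<close> and \<open>-\<theta> / g\<close> times the transformed surface. The formula is
  invariant under changes of adapted coordinates, so it defines a global map.
\<close>

section \<open>Calculus of smooth maps on plane domains\<close>

definition dder :: "complex \<Rightarrow> (complex \<Rightarrow> 'b::real_normed_vector) \<Rightarrow> complex \<Rightarrow> 'b" where
  "dder v f p = frechet_derivative f (at p) v"

lemma Ck_on_Suc_dder:
  "Ck_on (Suc k) D f \<longleftrightarrow> (\<forall>p\<in>D. f differentiable (at p)) \<and> (\<forall>v. Ck_on k D (dder v f))"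
  by (simp add: dder_def[abs_def])

lemma has_derivative_dder:
  "f differentiable (at p) \<Longrightarrow> (f has_derivative (\<lambda>v. dder v f p)) (at p)"
  unfolding dder_def using frechet_derivative_works by blast

lemma dder_eq: "(f has_derivative f') (at p) \<Longrightarrow> dder v f p = f' v"
  unfolding dder_def using frechet_derivative_at by metis

lemma dder_cong:
  assumes "open D" "p \<in> D" "\<And>q. q \<in> D \<Longrightarrow> f q = g q"
  shows "dder v f p = dder v g p"
proof -
  have "(f has_derivative F) (at p) \<longleftrightarrow> (g has_derivative F) (at p)" for F
    using assms has_derivative_transform_within_open[of f F p UNIV D g]
      has_derivative_transform_within_open[of g F p UNIV D f] by auto
  then show ?thesis unfolding dder_def frechet_derivative_def by simp
qed

lemma differentiable_cong:
  assumes "open D" "p \<in> D" "\<And>q. q \<in> D \<Longrightarrow> f q = g q" "f differentiable (at p)"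
  shows "g differentiable (at p)"
  using assms has_derivative_transform_within_open[of f _ p UNIV D g]
  unfolding differentiable_def by blast

lemma Ck_on_cong:
  assumes "open D" "\<And>q. q \<in> D \<Longrightarrow> f q = g q"
  shows "Ck_on k D f \<longleftrightarrow> Ck_on k D g"
  using assms(2)
proof (induction k arbitrary: f g)
  case 0
  then show ?case by (simp cong: continuous_on_cong)
next
  case (Suc k)
  have "Ck_on k D (dder v f) \<longleftrightarrow> Ck_on k D (dder v g)" for v
    by (rule Suc.IH) (use Suc.prems dder_cong[OF assms(1)] in blast)
  moreover have "f differentiable (at p) \<longleftrightarrow> g differentiable (at p)" if "p \<in> D" for p
    using Suc.prems differentiable_cong[OF assms(1) that] by metis
  ultimately show ?case unfolding Ck_on_Suc_dder by blast
qed

lemma Ck_on_Suc_imp: "Ck_on (Suc k) D f \<Longrightarrow> Ck_on k D f"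
proof (induction k arbitrary: f)
  case 0
  then show ?case
    by (auto intro!: continuous_at_imp_continuous_on differentiable_imp_continuous_within)
next
  case (Suc k)
  then show ?case unfolding Ck_on_Suc_dder[of "Suc k"] Ck_on_Suc_dder[of k D f] by blast
qed

lemma Ck_on_subset: "Ck_on k D f \<Longrightarrow> E \<subseteq> D \<Longrightarrow> Ck_on k E f"
  by (induction k arbitrary: f) (auto intro: continuous_on_subset)

lemma Ck_on_local:
  assumes "\<And>p. p \<in> D \<Longrightarrow> \<exists>W. open W \<and> p \<in> W \<and> Ck_on k W f"
  shows "Ck_on k D f"
  using assms
proof (induction k arbitrary: f)
  case 0
  have "continuous (at p) f" if p: "p \<in> D" for p
  proof -
    obtain W where "open W" "p \<in> W" "continuous_on W f" using 0[OF p] by auto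
    then show ?thesis by (simp add: continuous_on_eq_continuous_at)
  qed
  then show ?case by (simp add: continuous_at_imp_continuous_on)
next
  case (Suc k)
  have "Ck_on k D (dder v f)" for v
    by (rule Suc.IH) (use Suc.prems in \<open>unfold Ck_on_Suc_dder, blast\<close>)
  moreover have "f differentiable (at p)" if "p \<in> D" for p
    using Suc.prems[OF that] unfolding Ck_on_Suc_dder by blast
  ultimately show ?case unfolding Ck_on_Suc_dder by blast
qed

lemma Ck_on_SucI:
  assumes "open D" "\<And>p. p \<in> D \<Longrightarrow> (f has_derivative f' p) (at p)"
    "\<And>v. Ck_on k D (\<lambda>p. f' p v)"
  shows "Ck_on (Suc k) D f"
proof -
  have "Ck_on k D (dder v f)" for v
    by (rule iffD2[OF Ck_on_cong[OF assms(1), of "dder v f" "\<lambda>p. f' p v"]])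
       (use assms dder_eq[OF assms(2)] in auto)
  then show ?thesis using assms(2) unfolding Ck_on_Suc_dder differentiable_def by blast
qed

lemma Ck_on_const: "Ck_on k D (\<lambda>p. c)"
  by (induction k arbitrary: c) auto

lemma Ck_on_bounded_linear:
  assumes "open D" "bounded_linear L" "Ck_on k D f"
  shows "Ck_on k D (\<lambda>p. L (f p))"
  using assms(3)
proof (induction k arbitrary: f)
  case 0
  then show ?case using assms(2) by (simp add: linear_continuous_on_compose bounded_linear.continuous_on)
next
  case (Suc k)
  have f: "\<And>p. p \<in> D \<Longrightarrow> f differentiable (at p)" "\<And>v. Ck_on k D (dder v f)"
    using Suc.prems unfolding Ck_on_Suc_dder by blast+
  show ?case
    by (rule Ck_on_SucI[OF assms(1) bounded_linear.has_derivative[OF assms(2) has_derivative_dder]])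
       (use f Suc.IH in auto)
qed

lemma Ck_on_add:
  assumes "open D" "Ck_on k D f" "Ck_on k D g"
  shows "Ck_on k D (\<lambda>p. f p + g p)"
  using assms(2,3)
proof (induction k arbitrary: f g)
  case 0
  then show ?case by (simp add: continuous_on_add)
next
  case (Suc k)
  have f: "\<And>p. p \<in> D \<Longrightarrow> f differentiable (at p)" "\<And>v. Ck_on k D (dder v f)"
    using Suc.prems unfolding Ck_on_Suc_dder by blast+
  have g: "\<And>p. p \<in> D \<Longrightarrow> g differentiable (at p)" "\<And>v. Ck_on k D (dder v g)"
    using Suc.prems unfolding Ck_on_Suc_dder by blast+
  show ?case
    by (rule Ck_on_SucI[OF assms(1) has_derivative_add[OF has_derivative_dder has_derivative_dder]])
       (use f g Suc.IH in auto)
qed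

lemma Ck_on_bilinear:
  assumes "open D" "bounded_bilinear B" "Ck_on k D f" "Ck_on k D g"
  shows "Ck_on k D (\<lambda>p. B (f p) (g p))"
  using assms(3,4)
proof (induction k arbitrary: f g)
  case 0
  then show ?case using assms(2) by (simp add: bounded_bilinear.continuous_on)
next
  case (Suc k)
  have f: "\<And>p. p \<in> D \<Longrightarrow> f differentiable (at p)" "\<And>v. Ck_on k D (dder v f)" "Ck_on k D f"
    using Suc.prems Ck_on_Suc_imp unfolding Ck_on_Suc_dder by blast+
  have g: "\<And>p. p \<in> D \<Longrightarrow> g differentiable (at p)" "\<And>v. Ck_on k D (dder v g)" "Ck_on k D g"
    using Suc.prems Ck_on_Suc_imp unfolding Ck_on_Suc_dder by blast+
  show ?case
    by (rule Ck_on_SucI[OF assms(1) bounded_bilinear.FDERIV[OF assms(2) has_derivative_dder has_derivative_dder]])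
       (use f g in \<open>auto intro!: Ck_on_add[OF assms(1)] Suc.IH\<close>)
qed

lemma Ck_on_inverse:
  fixes f :: "complex \<Rightarrow> real"
  assumes "open D" "Ck_on k D f" "\<And>p. p \<in> D \<Longrightarrow> f p \<noteq> 0"
  shows "Ck_on k D (\<lambda>p. inverse (f p))"
  using assms(2,3)
proof (induction k arbitrary: f)
  case 0
  then show ?case by (simp add: continuous_on_inverse)
next
  case (Suc k)
  have f: "\<And>p. p \<in> D \<Longrightarrow> f differentiable (at p)" "\<And>v. Ck_on k D (dder v f)" "Ck_on k D f"
    using Suc.prems Ck_on_Suc_imp unfolding Ck_on_Suc_dder by blast+
  have i: "Ck_on k D (\<lambda>p. inverse (f p))" using Suc.IH f(3) Suc.prems(2) by blast
  show ?case
  proof (rule Ck_on_SucI[OF assms(1)])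
    show "((\<lambda>p. inverse (f p)) has_derivative (\<lambda>v. - (inverse (f p) * dder v f p * inverse (f p)))) (at p)"
      if "p \<in> D" for p
      by (rule Deriv.has_derivative_inverse[OF Suc.prems(2)[OF that] has_derivative_dder[OF f(1)[OF that]]])
    show "Ck_on k D (\<lambda>p. - (inverse (f p) * dder v f p * inverse (f p)))" for v
      by (intro Ck_on_bounded_linear[OF assms(1) bounded_linear_minus[OF bounded_linear_ident]]
          Ck_on_bilinear[OF assms(1) bounded_bilinear_mult] i f)
  qed
qed

lemma smooth_on_dder: "smooth_on D f \<Longrightarrow> smooth_on D (dder v f)"
  unfolding smooth_on_def using Ck_on_Suc_dder by blast

lemma smooth_on_differentiable: "smooth_on D f \<Longrightarrow> p \<in> D \<Longrightarrow> f differentiable (at p)"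
  unfolding smooth_on_def using Ck_on_Suc_dder by blast

lemma smooth_on_has_derivative:
  "smooth_on D f \<Longrightarrow> p \<in> D \<Longrightarrow> (f has_derivative (\<lambda>v. dder v f p)) (at p)"
  using smooth_on_differentiable has_derivative_dder by blast

lemma smooth_on_continuous: "smooth_on D f \<Longrightarrow> continuous_on D f"
  unfolding smooth_on_def using Ck_on.simps(1) by blast

lemma smooth_on_subset: "smooth_on D f \<Longrightarrow> E \<subseteq> D \<Longrightarrow> smooth_on E f"
  unfolding smooth_on_def using Ck_on_subset by blast

lemma smooth_on_cong:
  "open D \<Longrightarrow> (\<And>q. q \<in> D \<Longrightarrow> f q = g q) \<Longrightarrow> smooth_on D f \<longleftrightarrow> smooth_on D g"
  unfolding smooth_on_def using Ck_on_cong by blast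

lemma smooth_on_local:
  "(\<And>p. p \<in> D \<Longrightarrow> \<exists>W. open W \<and> p \<in> W \<and> smooth_on W f) \<Longrightarrow> smooth_on D f"
  unfolding smooth_on_def by (intro allI Ck_on_local) blast

lemma smooth_on_const: "smooth_on D (\<lambda>p. c)"
  by (simp add: smooth_on_def Ck_on_const)

lemma smooth_on_bounded_linear:
  "open D \<Longrightarrow> bounded_linear L \<Longrightarrow> smooth_on D f \<Longrightarrow> smooth_on D (\<lambda>p. L (f p))"
  by (simp add: smooth_on_def Ck_on_bounded_linear)

lemma smooth_on_add:
  "open D \<Longrightarrow> smooth_on D f \<Longrightarrow> smooth_on D g \<Longrightarrow> smooth_on D (\<lambda>p. f p + g p)"
  by (simp add: smooth_on_def Ck_on_add)

lemma smooth_on_bilinear: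
  "open D \<Longrightarrow> bounded_bilinear B \<Longrightarrow> smooth_on D f \<Longrightarrow> smooth_on D g \<Longrightarrow> smooth_on D (\<lambda>p. B (f p) (g p))"
  by (simp add: smooth_on_def Ck_on_bilinear)

lemma smooth_on_scaleR:
  "open D \<Longrightarrow> smooth_on D f \<Longrightarrow> smooth_on D g \<Longrightarrow> smooth_on D (\<lambda>p. f p *\<^sub>R g p)"
  by (rule smooth_on_bilinear[OF _ bounded_bilinear_scaleR])

lemma smooth_on_mult:
  fixes f g :: "complex \<Rightarrow> real"
  shows "open D \<Longrightarrow> smooth_on D f \<Longrightarrow> smooth_on D g \<Longrightarrow> smooth_on D (\<lambda>p. f p * g p)"
  by (rule smooth_on_bilinear[OF _ bounded_bilinear_mult])

lemma smooth_on_divide: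
  fixes f g :: "complex \<Rightarrow> real"
  assumes "open D" "smooth_on D f" "smooth_on D g" "\<And>p. p \<in> D \<Longrightarrow> g p \<noteq> 0"
  shows "smooth_on D (\<lambda>p. f p / g p)"
  unfolding divide_inverse using assms
  by (intro smooth_on_mult) (auto simp: smooth_on_def Ck_on_inverse)

lemma bounded_linear_dder:
  assumes "open D" "p \<in> D" "smooth_on D f" "bounded_linear L"
  shows "dder v (\<lambda>q. L (f q)) p = L (dder v f p)"
  by (rule dder_eq) (rule bounded_linear.has_derivative[OF assms(4) smooth_on_has_derivative[OF assms(3,2)]])

lemma mvt_dder:
  fixes f :: "complex \<Rightarrow> real"
  assumes "0 < t" "\<And>s. 0 \<le> s \<Longrightarrow> s \<le> t \<Longrightarrow> f differentiable (at (p + s *\<^sub>R u))"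
  shows "\<exists>s. 0 < s \<and> s < t \<and> f (p + t *\<^sub>R u) - f p = t * dder u f (p + s *\<^sub>R u)"
proof -
  have "((\<lambda>s. f (p + s *\<^sub>R u)) has_real_derivative dder u f (p + s *\<^sub>R u)) (at s)"
    if "0 \<le> s" "s \<le> t" for s
  proof -
    have lin: "linear (\<lambda>v. dder v f (p + s *\<^sub>R u))"
      using has_derivative_dder[OF assms(2)[OF that]] has_derivative_linear by blast
    have "((\<lambda>s. p + s *\<^sub>R u) has_derivative (\<lambda>h. h *\<^sub>R u)) (at s)"
      by (auto intro!: derivative_eq_intros)
    from diff_chain_at[OF this has_derivative_dder[OF assms(2)[OF that]]]
    have "((\<lambda>s. f (p + s *\<^sub>R u)) has_derivative (\<lambda>h. dder (h *\<^sub>R u) f (p + s *\<^sub>R u))) (at s)"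
      by (simp add: o_def)
    then show ?thesis
      using linear_scale[OF lin] by (simp add: has_field_derivative_def mult.commute[of _ "dder _ _ _"] mult_commute_abs)
  qed
  from MVT2[OF assms(1), of "\<lambda>s. f (p + s *\<^sub>R u)" "\<lambda>s. dder u f (p + s *\<^sub>R u)"] this
  show ?thesis by auto
qed

lemma dder_commute_real:
  fixes f :: "complex \<Rightarrow> real"
  assumes "open D" "p \<in> D" "smooth_on D f"
  shows "dder u (dder v f) p = dder v (dder u f) p"
proof -
  have key: "\<exists>r>0. \<forall>t. 0 < t \<and> t < r \<longrightarrow>
      \<bar>(f (p + t *\<^sub>R u + t *\<^sub>R v) - f (p + t *\<^sub>R u) - (f (p + t *\<^sub>R v) - f p)) / t\<^sup>2 - dder v (dder u f) p\<bar> < e"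
    if e: "0 < e" for e u v
  proof -
    have "continuous_on D (dder v (dder u f))"
      by (intro smooth_on_continuous smooth_on_dder assms)
    then have "continuous (at p) (dder v (dder u f))"
      using assms by (simp add: continuous_on_eq_continuous_at)
    then obtain d1 where d1: "d1 > 0"
      "\<And>q. dist q p < d1 \<Longrightarrow> \<bar>dder v (dder u f) q - dder v (dder u f) p\<bar> < e"
      unfolding continuous_at_eps_delta dist_real_def using e by metis
    obtain d2 where d2: "d2 > 0" "ball p d2 \<subseteq> D" using assms open_contains_ball by blast
    define r where "r = min d1 d2 / (norm u + norm v + 1)"
    have r: "r > 0" unfolding r_def using d1 d2 by (simp add: add_nonneg_pos)
    have near: "dist (p + s *\<^sub>R u + s' *\<^sub>R v) p < min d1 d2"
      if "0 \<le> s" "s \<le> t" "0 \<le> s'" "s' \<le> t" "0 < t" "t < r" for s s' t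
    proof -
      have "dist (p + s *\<^sub>R u + s' *\<^sub>R v) p = norm (s *\<^sub>R u + s' *\<^sub>R v)"
        by (simp add: dist_norm add.assoc)
      also have "\<dots> \<le> s * norm u + s' * norm v"
        using that by (metis norm_triangle_ineq norm_scaleR abs_of_nonneg)
      also have "\<dots> \<le> t * norm u + t * norm v"
        using that by (intro add_mono mult_right_mono) auto
      also have "\<dots> < t * (norm u + norm v + 1)" using that by (simp add: algebra_simps)
      also have "\<dots> < r * (norm u + norm v + 1)"
        using that by (intro mult_strict_right_mono) (auto simp: add_nonneg_pos)
      also have "\<dots> = min d1 d2" unfolding r_def by (simp add: add_nonneg_eq_0_iff)
      finally show ?thesis .
    qed
    have inD: "p + s *\<^sub>R u + s' *\<^sub>R v \<in> D"
      if "0 \<le> s" "s \<le> t" "0 \<le> s'" "s' \<le> t" "0 < t" "t < r" for s s' t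
      using near[OF that] d2(2) by (auto simp: subset_iff dist_commute)
    have "\<bar>(f (p + t *\<^sub>R u + t *\<^sub>R v) - f (p + t *\<^sub>R u) - (f (p + t *\<^sub>R v) - f p)) / t\<^sup>2 - dder v (dder u f) p\<bar> < e"
      if t: "0 < t" "t < r" for t
    proof -
      define F where "F = (\<lambda>q. f (q + t *\<^sub>R v) - f q)"
      have dF: "(F has_derivative (\<lambda>w. dder w f (q + t *\<^sub>R v) - dder w f q)) (at q)"
        if "q \<in> D" "q + t *\<^sub>R v \<in> D" for q
      proof -
        have "((\<lambda>q. q + t *\<^sub>R v) has_derivative (\<lambda>w. w)) (at q)"
          by (auto intro!: derivative_eq_intros)
        from diff_chain_at[OF this smooth_on_has_derivative[OF assms(3) that(2)]]
        show ?thesis unfolding F_def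
          by (intro has_derivative_diff smooth_on_has_derivative[OF assms(3) that(1)]) (simp add: o_def)
      qed
      have sD: "p + s *\<^sub>R u \<in> D" "p + s *\<^sub>R u + t *\<^sub>R v \<in> D" if "0 \<le> s" "s \<le> t" for s
        using inD[of s t 0] inD[of s t t] t that by auto
      obtain s where s: "0 < s" "s < t" "F (p + t *\<^sub>R u) - F p = t * dder u F (p + s *\<^sub>R u)"
        using mvt_dder[OF t(1), of F p u] dF sD unfolding differentiable_def by blast
      have "dder u F (p + s *\<^sub>R u) = dder u f (p + s *\<^sub>R u + t *\<^sub>R v) - dder u f (p + s *\<^sub>R u)"
        using dder_eq[OF dF] sD s by auto
      moreover obtain s' where s': "0 < s'" "s' < t"
        "dder u f (p + s *\<^sub>R u + t *\<^sub>R v) - dder u f (p + s *\<^sub>R u) = t * dder v (dder u f) (p + s *\<^sub>R u + s' *\<^sub>R v)"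
        using mvt_dder[OF t(1), of "dder u f" "p + s *\<^sub>R u" v]
          smooth_on_differentiable[OF smooth_on_dder[OF assms(3)] inD[of s t]] s t by auto
      ultimately have "F (p + t *\<^sub>R u) - F p = t\<^sup>2 * dder v (dder u f) (p + s *\<^sub>R u + s' *\<^sub>R v)"
        using s by (simp add: power2_eq_square)
      then have "(f (p + t *\<^sub>R u + t *\<^sub>R v) - f (p + t *\<^sub>R u) - (f (p + t *\<^sub>R v) - f p)) / t\<^sup>2
          = dder v (dder u f) (p + s *\<^sub>R u + s' *\<^sub>R v)"
        unfolding F_def using t by simp
      then show ?thesis using d1(2) near[of s t s'] s s' t by simp
    qed
    then show ?thesis using r by blast
  qed
  show ?thesis
  proof (rule ccontr)
    assume ne: "dder u (dder v f) p \<noteq> dder v (dder u f) p"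
    define e where "e = \<bar>dder u (dder v f) p - dder v (dder u f) p\<bar> / 2"
    have e: "e > 0" using ne by (simp add: e_def)
    obtain r1 where r1: "r1 > 0" "\<And>t. 0 < t \<Longrightarrow> t < r1 \<Longrightarrow> 
      \<bar>(f (p + t *\<^sub>R u + t *\<^sub>R v) - f (p + t *\<^sub>R u) - (f (p + t *\<^sub>R v) - f p)) / t\<^sup>2 - dder v (dder u f) p\<bar> < e"
      using key[OF e, of u v] by blast
    obtain r2 where r2: "r2 > 0" "\<And>t. 0 < t \<Longrightarrow> t < r2 \<Longrightarrow> 
      \<bar>(f (p + t *\<^sub>R v + t *\<^sub>R u) - f (p + t *\<^sub>R v) - (f (p + t *\<^sub>R u) - f p)) / t\<^sup>2 - dder u (dder v f) p\<bar> < e"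
      using key[OF e, of v u] by blast
    define t where "t = min r1 r2 / 2"
    have t: "0 < t" "t < r1" "t < r2" using r1(1) r2(1) by (auto simp: t_def)
    have "f (p + t *\<^sub>R v + t *\<^sub>R u) - f (p + t *\<^sub>R v) - (f (p + t *\<^sub>R u) - f p)
       = f (p + t *\<^sub>R u + t *\<^sub>R v) - f (p + t *\<^sub>R u) - (f (p + t *\<^sub>R v) - f p)"
      by (simp add: algebra_simps)
    moreover have "\<not> (\<bar>x - a\<bar> < \<bar>b - a\<bar> / 2 \<and> \<bar>x - b\<bar> < \<bar>b - a\<bar> / 2)" for x a b :: real
    proof -
      have "\<bar>b - a\<bar> \<le> \<bar>x - a\<bar> + \<bar>x - b\<bar>" by simp
      moreover have "\<bar>x - a\<bar> + \<bar>x - b\<bar> < \<bar>b - a\<bar> / 2 + \<bar>b - a\<bar> / 2"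
        if "\<bar>x - a\<bar> < \<bar>b - a\<bar> / 2 \<and> \<bar>x - b\<bar> < \<bar>b - a\<bar> / 2"
        using that by (intro add_strict_mono) auto
      ultimately show ?thesis by auto
    qed
    ultimately show False
      using r1(2)[OF t(1,2)] r2(2)[OF t(1,3)] unfolding e_def by metis
  qed
qed

lemma dder_commute:
  fixes f :: "complex \<Rightarrow> real ^ 'm"
  assumes "open D" "p \<in> D" "smooth_on D f"
  shows "dder u (dder v f) p = dder v (dder u f) p"
proof (rule vec_eq_iff[THEN iffD2], rule allI)
  fix i
  have s: "smooth_on D (\<lambda>q. f q $ i)"
    by (rule smooth_on_bounded_linear[OF assms(1) bounded_linear_vec_nth assms(3)])
  have c: "dder u (dder v (\<lambda>q. f q $ i)) p = dder u (dder v f) p $ i" for u v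
  proof -
    have "dder u (dder v (\<lambda>q. f q $ i)) p = dder u (\<lambda>q. dder v f q $ i) p"
      by (rule dder_cong[OF assms(1,2)]) (rule bounded_linear_dder[OF assms(1) _ assms(3) bounded_linear_vec_nth])
    also have "\<dots> = dder u (dder v f) p $ i"
      by (rule bounded_linear_dder[OF assms(1,2) smooth_on_dder[OF assms(3)] bounded_linear_vec_nth])
    finally show ?thesis .
  qed
  show "dder u (dder v f) p $ i = dder v (dder u f) p $ i"
    using dder_commute_real[OF assms(1,2) s, of u v] c by metis
qed

abbreviation d1 :: "(complex \<Rightarrow> 'b::real_normed_vector) \<Rightarrow> complex \<Rightarrow> 'b" where "d1 \<equiv> dder 1"
abbreviation d2 :: "(complex \<Rightarrow> 'b::real_normed_vector) \<Rightarrow> complex \<Rightarrow> 'b" where "d2 \<equiv> dder \<i>"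

lemma dder_decompose:
  assumes "f differentiable (at p)"
  shows "dder v f p = Re v *\<^sub>R d1 f p + Im v *\<^sub>R d2 f p"
proof -
  have lin: "linear (\<lambda>v. dder v f p)"
    using has_derivative_dder[OF assms] has_derivative_linear by blast
  have "v = Re v *\<^sub>R 1 + Im v *\<^sub>R \<i>" by (simp add: complex_eq_iff)
  then have "dder v f p = dder (Re v *\<^sub>R 1 + Im v *\<^sub>R \<i>) f p" by simp
  also have "\<dots> = Re v *\<^sub>R d1 f p + Im v *\<^sub>R d2 f p"
    by (simp only: linear_add[OF lin] linear_scale[OF lin])
  finally show ?thesis .
qed

lemma sig_inner_sum: "sig_inner N x y = (\<Sum>i\<in>UNIV. (if i \<in> N then -1 else 1) * (x $ i * y $ i))"
proof -
  have "(\<Sum>i\<in>UNIV. (if i \<in> N then -1 else 1) * (x $ i * y $ i))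
      = (\<Sum>i\<in>-N. (if i \<in> N then -1 else 1) * (x $ i * y $ i)) + (\<Sum>i\<in>N. (if i \<in> N then -1 else 1) * (x $ i * y $ i))"
    by (subst sum.union_disjoint[symmetric]) auto
  also have "\<dots> = sig_inner N x y" unfolding sig_inner_def by (simp add: sum_negf)
  finally show ?thesis by simp
qed

lemma sig_inner_commute: "sig_inner N x y = sig_inner N y x"
  unfolding sig_inner_def by (simp add: mult.commute)

lemma sig_inner_add_left: "sig_inner N (x + y) z = sig_inner N x z + sig_inner N y z"
  unfolding sig_inner_def by (simp add: sum.distrib algebra_simps)

lemma sig_inner_scaleR_left: "sig_inner N (a *\<^sub>R x) (z :: real ^ 'm::finite) = a * sig_inner N x z"
  unfolding sig_inner_def by (simp add: sum_distrib_left algebra_simps)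

lemma sig_inner_add_right: "sig_inner N z (x + y) = sig_inner N z x + sig_inner N z y"
  using sig_inner_add_left sig_inner_commute by metis

lemma sig_inner_scaleR_right: "sig_inner N (z :: real ^ 'm::finite) (a *\<^sub>R x) = a * sig_inner N z x"
  using sig_inner_scaleR_left sig_inner_commute by metis

lemma bounded_bilinear_sig_inner: "bounded_bilinear (sig_inner N :: real ^ 'm::finite \<Rightarrow> _)"
  by (subst bilinear_conv_bounded_bilinear[symmetric])
     (auto simp: bilinear_def sig_inner_add_left sig_inner_add_right sig_inner_scaleR_left
       sig_inner_scaleR_right intro!: linearI)

lemmas sig_inner_simps =
  sig_inner_add_left sig_inner_add_right sig_inner_scaleR_left sig_inner_scaleR_right
  bounded_bilinear.diff_left[OF bounded_bilinear_sig_inner] bounded_bilinear.diff_right[OF bounded_bilinear_sig_inner]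
  bounded_bilinear.minus_left[OF bounded_bilinear_sig_inner] bounded_bilinear.minus_right[OF bounded_bilinear_sig_inner]
  bounded_bilinear.zero_left[OF bounded_bilinear_sig_inner] bounded_bilinear.zero_right[OF bounded_bilinear_sig_inner]

lemma smooth_on_sig_inner:
  "open D \<Longrightarrow> smooth_on D f \<Longrightarrow> smooth_on D g \<Longrightarrow> smooth_on D (\<lambda>p. sig_inner N (f p) (g p) :: real)"
  by (rule smooth_on_bilinear[OF _ bounded_bilinear_sig_inner])

lemma dder_sig_inner:
  assumes "smooth_on D f" "smooth_on D g" "p \<in> D"
  shows "dder v (\<lambda>p. sig_inner N (f p) (g p) :: real) p = sig_inner N (f p) (dder v g p) + sig_inner N (dder v f p) (g p)"
  by (rule dder_eq[OF bounded_bilinear.FDERIV[OF bounded_bilinear_sig_inner smooth_on_has_derivative smooth_on_has_derivative]])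
     (use assms in auto)

lemma dder_sig_inner_const:
  assumes "open D" "smooth_on D f" "smooth_on D g" "\<And>q. q \<in> D \<Longrightarrow> sig_inner N (f q) (g q) = c" "p \<in> D"
  shows "sig_inner N (f p) (dder v g p) + sig_inner N (dder v f p) (g p) = (0 :: real)"
proof -
  have "dder v (\<lambda>p. sig_inner N (f p) (g p)) p = dder v (\<lambda>p. c) p"
    by (rule dder_cong[OF assms(1,5)]) (rule assms(4))
  also have "\<dots> = 0" by (simp add: dder_def)
  finally show ?thesis using dder_sig_inner[OF assms(2,3,5)] by metis
qed


lemma Re_vec_cvec [simp]: "Re_vec (cvec x) = x" and Im_vec_cvec [simp]: "Im_vec (cvec x) = 0"
  by (auto simp: Re_vec_def Im_vec_def cvec_def vec_eq_iff)

lemma Re_Im_vec_add [simp]: "Re_vec (x + y) = Re_vec x + Re_vec y" "Im_vec (x + y) = Im_vec x + Im_vec y"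
  and Re_Im_vec_diff [simp]: "Re_vec (x - y) = Re_vec x - Re_vec y" "Im_vec (x - y) = Im_vec x - Im_vec y"
  and Re_Im_vec_smult [simp]: "Re_vec (a *s x) = Re a *\<^sub>R Re_vec x - Im a *\<^sub>R Im_vec x"
    "Im_vec (a *s x) = Re a *\<^sub>R Im_vec x + Im a *\<^sub>R Re_vec x"
  and Re_Im_vec_zero [simp]: "Re_vec 0 = 0" "Im_vec 0 = 0"
  and Re_Im_vec_scaleR [simp]: "Re_vec (t *\<^sub>R x) = t *\<^sub>R Re_vec x" "Im_vec (t *\<^sub>R x) = t *\<^sub>R Im_vec x"
  by (auto simp: Re_vec_def Im_vec_def vec_eq_iff)

lemma Re_Im_vec_eqI: "Re_vec x = Re_vec y \<Longrightarrow> Im_vec x = Im_vec y \<Longrightarrow> x = y"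
  by (auto simp: Re_vec_def Im_vec_def vec_eq_iff complex_eq_iff)

lemma bounded_linear_Re_vec: "bounded_linear (Re_vec :: complex ^ 'm::finite \<Rightarrow> _)"
  and bounded_linear_Im_vec: "bounded_linear (Im_vec :: complex ^ 'm::finite \<Rightarrow> _)"
  by (auto simp: linear_conv_bounded_linear[symmetric] intro!: linearI)

lemma bounded_linear_cvec: "bounded_linear (cvec :: real ^ 'm::finite \<Rightarrow> _)"
  by (auto simp: linear_conv_bounded_linear[symmetric] cvec_def vec_eq_iff complex_eq_iff intro!: linearI)

lemma range_cvec_iff: "x \<in> range cvec \<longleftrightarrow> Im_vec x = 0"
proof
  assume "Im_vec x = 0"
  then have "x = cvec (Re_vec x)" by (intro Re_Im_vec_eqI) auto
  then show "x \<in> range cvec" by blast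
qed auto

lemma complexify_iff:
  assumes "subspace S"
  shows "x \<in> complexify S \<longleftrightarrow> Re_vec x \<in> S \<and> Im_vec x \<in> S"
proof
  have "vec.subspace {x. Re_vec x \<in> S \<and> Im_vec x \<in> S}"
    unfolding vec.subspace_def
    using assms by (auto simp: subspace_0 subspace_add subspace_diff subspace_scale)
  moreover have "cvec ` S \<subseteq> {x. Re_vec x \<in> S \<and> Im_vec x \<in> S}"
    using assms by (auto simp: subspace_0)
  moreover assume "x \<in> complexify S"
  ultimately show "Re_vec x \<in> S \<and> Im_vec x \<in> S"
    unfolding complexify_def using vec.span_minimal by blast
next
  assume a: "Re_vec x \<in> S \<and> Im_vec x \<in> S"
  have "x = cvec (Re_vec x) + \<i> *s cvec (Im_vec x)" by (intro Re_Im_vec_eqI) auto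
  moreover have "cvec (Re_vec x) + \<i> *s cvec (Im_vec x) \<in> complexify S"
    unfolding complexify_def using a by (intro vec.span_add vec.span_scale vec.span_base) auto
  ultimately show "x \<in> complexify S" by simp
qed

lemma Re_Im_d_z:
  assumes "F differentiable (at p)"
  shows "Re_vec (d_z F p) = (1/2) *\<^sub>R (d1 (\<lambda>q. Re_vec (F q)) p + d2 (\<lambda>q. Im_vec (F q)) p)"
    "Im_vec (d_z F p) = (1/2) *\<^sub>R (d1 (\<lambda>q. Im_vec (F q)) p - d2 (\<lambda>q. Re_vec (F q)) p)"
    "Re_vec (d_zbar F p) = (1/2) *\<^sub>R (d1 (\<lambda>q. Re_vec (F q)) p - d2 (\<lambda>q. Im_vec (F q)) p)"
    "Im_vec (d_zbar F p) = (1/2) *\<^sub>R (d1 (\<lambda>q. Im_vec (F q)) p + d2 (\<lambda>q. Re_vec (F q)) p)"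
proof -
  have R: "dder v (\<lambda>q. Re_vec (F q)) p = Re_vec (frechet_derivative F (at p) v)" for v
    by (rule dder_eq[OF bounded_linear.has_derivative[OF bounded_linear_Re_vec]])
       (use assms frechet_derivative_works in blast)
  have I: "dder v (\<lambda>q. Im_vec (F q)) p = Im_vec (frechet_derivative F (at p) v)" for v
    by (rule dder_eq[OF bounded_linear.has_derivative[OF bounded_linear_Im_vec]])
       (use assms frechet_derivative_works in blast)
  show "Re_vec (d_z F p) = (1/2) *\<^sub>R (d1 (\<lambda>q. Re_vec (F q)) p + d2 (\<lambda>q. Im_vec (F q)) p)"
    "Im_vec (d_z F p) = (1/2) *\<^sub>R (d1 (\<lambda>q. Im_vec (F q)) p - d2 (\<lambda>q. Re_vec (F q)) p)"
    "Re_vec (d_zbar F p) = (1/2) *\<^sub>R (d1 (\<lambda>q. Re_vec (F q)) p - d2 (\<lambda>q. Im_vec (F q)) p)"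
    "Im_vec (d_zbar F p) = (1/2) *\<^sub>R (d1 (\<lambda>q. Im_vec (F q)) p + d2 (\<lambda>q. Re_vec (F q)) p)"
    unfolding R I d_z_def d_zbar_def by (auto simp: algebra_simps)
qed

lemma smooth_on_cfun: "open D \<Longrightarrow> smooth_on D f \<Longrightarrow> smooth_on D (cfun f)"
  by (rule smooth_on_bounded_linear[OF _ bounded_linear_cvec])

lemma bounded_linear_smult: "bounded_linear (\<lambda>x :: complex ^ 'm::finite. a *s x)"
  by (auto simp: linear_conv_bounded_linear[symmetric] vec_eq_iff algebra_simps intro!: linearI)

lemma smooth_on_d_z:
  assumes "open D" "smooth_on D F"
  shows "smooth_on D (d_z F)" "smooth_on D (d_zbar F)"
proof -
  have e: "d_z F = (\<lambda>p. (1/2) *s (d1 F p + (-\<i>) *s d2 F p))"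
    "d_zbar F = (\<lambda>p. (1/2) *s (d1 F p + \<i> *s d2 F p))"
    by (auto simp: d_z_def d_zbar_def dder_def fun_eq_iff)
  show "smooth_on D (d_z F)" "smooth_on D (d_zbar F)"
    unfolding e using assms
    by (intro smooth_on_bounded_linear[OF assms(1) bounded_linear_smult] smooth_on_add smooth_on_dder; simp)+
qed

lemma dder_scaleR_const:
  assumes "f differentiable (at p)"
  shows "dder v (\<lambda>q. a *\<^sub>R f q) p = a *\<^sub>R dder v f p"
  by (rule dder_eq[OF has_derivative_scaleR_right[OF has_derivative_dder[OF assms]]])

lemma dder_const: "dder v (\<lambda>q. a) p = 0"
  by (simp add: dder_def)

lemma Re_Im_d_z_cfun:
  assumes "f differentiable (at p)"
  shows "Re_vec (d_z (cfun f) p) = (1/2) *\<^sub>R d1 f p"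
    "Im_vec (d_z (cfun f) p) = - (1/2) *\<^sub>R d2 f p"
    "Re_vec (d_zbar (cfun f) p) = (1/2) *\<^sub>R d1 f p"
    "Im_vec (d_zbar (cfun f) p) = (1/2) *\<^sub>R d2 f p"
proof -
  have "cfun f differentiable (at p)"
    using bounded_linear.has_derivative[OF bounded_linear_cvec has_derivative_dder[OF assms]]
    unfolding differentiable_def by blast
  from Re_Im_d_z[OF this]
  show "Re_vec (d_z (cfun f) p) = (1/2) *\<^sub>R d1 f p"
    "Im_vec (d_z (cfun f) p) = - (1/2) *\<^sub>R d2 f p"
    "Re_vec (d_zbar (cfun f) p) = (1/2) *\<^sub>R d1 f p"
    "Im_vec (d_zbar (cfun f) p) = (1/2) *\<^sub>R d2 f p"
    by (auto simp: dder_const)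
qed

lemma Re_Im_d_z_d_z:
  assumes "open D" "smooth_on D f" "p \<in> D"
  shows "Re_vec (d_z (d_zbar (cfun f)) p) = (1/4) *\<^sub>R (d1 (d1 f) p + d2 (d2 f) p)"
    "Re_vec (d_z (d_z (cfun f)) p) = (1/4) *\<^sub>R (d1 (d1 f) p - d2 (d2 f) p)"
    "Im_vec (d_z (d_z (cfun f)) p) = - (1/2) *\<^sub>R d1 (d2 f) p"
proof -
  have df: "f differentiable (at q)" if "q \<in> D" for q
    using smooth_on_differentiable assms(2) that by blast
  have ddf: "dder v f differentiable (at p)" for v
    using smooth_on_differentiable smooth_on_dder assms by blast
  have z: "dder v (\<lambda>q. Re_vec (d_z (cfun f) q)) p = (1/2) *\<^sub>R dder v (d1 f) p"
    "dder v (\<lambda>q. Im_vec (d_z (cfun f) q)) p = - (1/2) *\<^sub>R dder v (d2 f) p"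
    "dder v (\<lambda>q. Re_vec (d_zbar (cfun f) q)) p = (1/2) *\<^sub>R dder v (d1 f) p"
    "dder v (\<lambda>q. Im_vec (d_zbar (cfun f) q)) p = (1/2) *\<^sub>R dder v (d2 f) p" for v
    using dder_cong[OF assms(1,3) Re_Im_d_z_cfun(1)[OF df], where v=v]
      dder_cong[OF assms(1,3) Re_Im_d_z_cfun(2)[OF df], where v=v]
      dder_cong[OF assms(1,3) Re_Im_d_z_cfun(3)[OF df], where v=v]
      dder_cong[OF assms(1,3) Re_Im_d_z_cfun(4)[OF df], where v=v]
    by (auto simp only: dder_scaleR_const[OF ddf])
  have "d_z (cfun f) differentiable (at p)" "d_zbar (cfun f) differentiable (at p)"
    using smooth_on_differentiable[OF smooth_on_d_z(1)[OF assms(1) smooth_on_cfun[OF assms(1,2)]] assms(3)]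
     smooth_on_differentiable[OF smooth_on_d_z(2)[OF assms(1) smooth_on_cfun[OF assms(1,2)]] assms(3)] by auto
  note Z = Re_Im_d_z[OF this(1)] Re_Im_d_z[OF this(2)]
  show "Re_vec (d_z (d_zbar (cfun f)) p) = (1/4) *\<^sub>R (d1 (d1 f) p + d2 (d2 f) p)"
    "Re_vec (d_z (d_z (cfun f)) p) = (1/4) *\<^sub>R (d1 (d1 f) p - d2 (d2 f) p)"
    unfolding Z z by (auto simp: algebra_simps scaleR_right_diff_distrib)
  show "Im_vec (d_z (d_z (cfun f)) p) = - (1/2) *\<^sub>R d1 (d2 f) p"
    unfolding Z z using dder_commute[OF assms(1,3,2), of \<i> 1]
    by (simp add: vec_eq_iff)
qed

section \<open>Canonical lifts in real coordinates\<close>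

locale conformal_frame =
  fixes N :: "'m::finite set" and W :: "complex set" and Y :: "complex \<Rightarrow> real ^ 'm"
  assumes open_W: "open W" and smooth_Y: "smooth_on W Y"
    and Y_Y: "\<And>p. p \<in> W \<Longrightarrow> sig_inner N (Y p) (Y p) = 0"
    and Y1_Y1: "\<And>p. p \<in> W \<Longrightarrow> sig_inner N (d1 Y p) (d1 Y p) = 1"
    and Y2_Y2: "\<And>p. p \<in> W \<Longrightarrow> sig_inner N (d2 Y p) (d2 Y p) = 1"
    and Y1_Y2: "\<And>p. p \<in> W \<Longrightarrow> sig_inner N (d1 Y p) (d2 Y p) = 0"
begin

abbreviation ip :: "real ^ 'm \<Rightarrow> real ^ 'm \<Rightarrow> real" (infix "\<odot>" 70) where
  "x \<odot> y \<equiv> sig_inner N x y"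

lemmas smooth_Ys = smooth_Y smooth_on_dder[OF smooth_Y] smooth_on_dder[OF smooth_on_dder[OF smooth_Y]]

lemma d2_d1_Y: "p \<in> W \<Longrightarrow> d2 (d1 Y) p = d1 (d2 Y) p"
  by (rule dder_commute[OF open_W _ smooth_Y])

lemma frame:
  assumes p: "p \<in> W"
  shows "Y p \<odot> d1 Y p = 0" "Y p \<odot> d2 Y p = 0"
    "Y p \<odot> d1 (d1 Y) p = -1" "Y p \<odot> d2 (d2 Y) p = -1" "Y p \<odot> d1 (d2 Y) p = 0"
    "d1 Y p \<odot> d1 (d1 Y) p = 0" "d1 Y p \<odot> d1 (d2 Y) p = 0" "d1 Y p \<odot> d2 (d2 Y) p = 0"
    "d2 Y p \<odot> d1 (d1 Y) p = 0" "d2 Y p \<odot> d1 (d2 Y) p = 0" "d2 Y p \<odot> d2 (d2 Y) p = 0"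
proof -
  note C = dder_sig_inner_const[where N=N, OF open_W]
  have Y1: "Y p \<odot> d1 Y p = 0" if "p \<in> W" for p
    using C[OF smooth_Ys(1) smooth_Ys(1) Y_Y that, of 1] by (simp add: sig_inner_commute)
  have Y2: "Y p \<odot> d2 Y p = 0" if "p \<in> W" for p
    using C[OF smooth_Ys(1) smooth_Ys(1) Y_Y that, of \<i>] by (simp add: sig_inner_commute)
  show "Y p \<odot> d1 Y p = 0" "Y p \<odot> d2 Y p = 0" using Y1 Y2 p by auto
  show Y11: "Y p \<odot> d1 (d1 Y) p = -1"
    using C[OF smooth_Ys(1) smooth_Ys(2) Y1 p, of 1] Y1_Y1[OF p] by simp
  show "Y p \<odot> d2 (d2 Y) p = -1"
    using C[OF smooth_Ys(1) smooth_Ys(2) Y2 p, of \<i>] Y2_Y2[OF p] by simp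
  show "Y p \<odot> d1 (d2 Y) p = 0"
    using C[OF smooth_Ys(1) smooth_Ys(2) Y2 p, of 1] Y1_Y2[OF p] by simp
  show "d1 Y p \<odot> d1 (d1 Y) p = 0"
    using C[OF smooth_Ys(2) smooth_Ys(2) Y1_Y1 p, of 1] by (simp add: sig_inner_commute)
  show a: "d1 Y p \<odot> d1 (d2 Y) p = 0"
    using C[OF smooth_Ys(2) smooth_Ys(2) Y1_Y1 p, of \<i>] d2_d1_Y[OF p] by (simp add: sig_inner_commute)
  show b: "d2 Y p \<odot> d1 (d2 Y) p = 0"
    using C[OF smooth_Ys(2) smooth_Ys(2) Y2_Y2 p, of 1] by (simp add: sig_inner_commute)
  show "d2 Y p \<odot> d2 (d2 Y) p = 0"
    using C[OF smooth_Ys(2) smooth_Ys(2) Y2_Y2 p, of \<i>] by (simp add: sig_inner_commute)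
  show "d1 Y p \<odot> d2 (d2 Y) p = 0"
    using C[OF smooth_Ys(2) smooth_Ys(2) Y1_Y2 p, of \<i>] d2_d1_Y[OF p] b by (simp add: sig_inner_commute)
  show "d2 Y p \<odot> d1 (d1 Y) p = 0"
    using C[OF smooth_Ys(2) smooth_Ys(2) Y1_Y2 p, of 1] a by (simp add: sig_inner_commute)
qed

lemma frame_sym:
  assumes p: "p \<in> W"
  shows "d1 Y p \<odot> Y p = 0" "d2 Y p \<odot> Y p = 0" "d2 Y p \<odot> d1 Y p = 0"
    "d1 (d1 Y) p \<odot> Y p = -1" "d2 (d2 Y) p \<odot> Y p = -1" "d1 (d2 Y) p \<odot> Y p = 0"
    "d1 (d1 Y) p \<odot> d1 Y p = 0" "d1 (d2 Y) p \<odot> d1 Y p = 0" "d2 (d2 Y) p \<odot> d1 Y p = 0"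
    "d1 (d1 Y) p \<odot> d2 Y p = 0" "d1 (d2 Y) p \<odot> d2 Y p = 0" "d2 (d2 Y) p \<odot> d2 Y p = 0"
  using frame[OF p] Y1_Y2[OF p] by (simp_all add: sig_inner_commute)

lemmas frame_simps = Y_Y Y1_Y1 Y2_Y2 Y1_Y2 frame frame_sym

lemma Y_nonzero: "p \<in> W \<Longrightarrow> Y p \<noteq> 0"
  using frame(3)[of p] by (auto simp: sig_inner_simps)

lemma V_space_eq:
  assumes p: "p \<in> W"
  shows "V_space Y p = span {Y p, d1 Y p, d2 Y p, d1 (d1 Y) p + d2 (d2 Y) p}" (is "_ = span ?B")
proof -
  have D: "Y differentiable (at p)" by (rule smooth_on_differentiable[OF smooth_Y p])
  have "V_space Y p = span {Y p, (1/2) *\<^sub>R d1 Y p, (-1/2) *\<^sub>R d2 Y p, (1/4) *\<^sub>R (d1 (d1 Y) p + d2 (d2 Y) p)}"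
    (is "_ = span ?A")
    unfolding V_space_def by (simp add: Re_Im_d_z_cfun[OF D] Re_Im_d_z_d_z[OF open_W smooth_Y p])
  also have "\<dots> = span ?B"
  proof (rule span_eq[THEN iffD2], intro conjI)
    show "?A \<subseteq> span ?B"
      by (auto intro!: span_scale span_neg intro: span_base)
    have "Y p \<in> span ?A" "2 *\<^sub>R (1/2) *\<^sub>R d1 Y p \<in> span ?A" "(-2) *\<^sub>R (-1/2) *\<^sub>R d2 Y p \<in> span ?A"
      "4 *\<^sub>R (1/4) *\<^sub>R (d1 (d1 Y) p + d2 (d2 Y) p) \<in> span ?A"
      by (intro span_base span_scale; simp)+
    then show "?B \<subseteq> span ?A" by simp
  qed
  finally show ?thesis .
qed

lemma V_space_iff:
  assumes p: "p \<in> W"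
  shows "x \<in> V_space Y p \<longleftrightarrow> (\<exists>\<alpha> \<beta> \<gamma> \<delta>. x = \<alpha> *\<^sub>R Y p + \<beta> *\<^sub>R d1 Y p + \<gamma> *\<^sub>R d2 Y p + \<delta> *\<^sub>R (d1 (d1 Y) p + d2 (d2 Y) p))"
  unfolding V_space_eq[OF p] span_breakdown_eq span_singleton
proof -
  have "(\<exists>\<alpha> \<beta> \<gamma>. x - \<alpha> *\<^sub>R Y p - \<beta> *\<^sub>R d1 Y p - \<gamma> *\<^sub>R d2 Y p \<in> span {d1 (d1 Y) p + d2 (d2 Y) p}) =
    (\<exists>\<alpha> \<beta> \<gamma> \<delta>. x = \<alpha> *\<^sub>R Y p + \<beta> *\<^sub>R d1 Y p + \<gamma> *\<^sub>R d2 Y p + \<delta> *\<^sub>R (d1 (d1 Y) p + d2 (d2 Y) p))"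
    unfolding span_singleton by (auto simp: diff_eq_eq add_ac image_iff)
  then show "(\<exists>k ka kb. x - k *\<^sub>R Y p - ka *\<^sub>R d1 Y p - kb *\<^sub>R d2 Y p \<in> range (\<lambda>k. k *\<^sub>R (d1 (d1 Y) p + d2 (d2 Y) p))) =
    (\<exists>\<alpha> \<beta> \<gamma> \<delta>. x = \<alpha> *\<^sub>R Y p + \<beta> *\<^sub>R d1 Y p + \<gamma> *\<^sub>R d2 Y p + \<delta> *\<^sub>R (d1 (d1 Y) p + d2 (d2 Y) p))"
    unfolding span_singleton .
qed

lemma V_perp_iff:
  assumes p: "p \<in> W"
  shows "x \<in> V_perp N Y p \<longleftrightarrow> x \<odot> Y p = 0 \<and> x \<odot> d1 Y p = 0 \<and> x \<odot> d2 Y p = 0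
    \<and> x \<odot> (d1 (d1 Y) p + d2 (d2 Y) p) = 0" (is "_ \<longleftrightarrow> ?R")
proof
  assume "x \<in> V_perp N Y p"
  then show ?R unfolding V_perp_def V_space_eq[OF p] by (auto intro: span_base)
next
  assume R: ?R
  have "x \<odot> v = 0" if v: "v \<in> V_space Y p" for v
  proof -
    obtain \<alpha> \<beta> \<gamma> \<delta> where "v = \<alpha> *\<^sub>R Y p + \<beta> *\<^sub>R d1 Y p + \<gamma> *\<^sub>R d2 Y p + \<delta> *\<^sub>R (d1 (d1 Y) p + d2 (d2 Y) p)"
      using v V_space_iff[OF p] by blast
    then show ?thesis using R by (simp add: sig_inner_add_right sig_inner_scaleR_right flip: distrib_left)
  qed
  then show "x \<in> V_perp N Y p" unfolding V_perp_def by simp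
qed

lemma subspace_V: "subspace (V_space Y p)" "subspace (V_perp N Y p)"
proof -
  show "subspace (V_space Y p)" unfolding V_space_def by (rule subspace_span)
  show "subspace (V_perp N Y p)" unfolding V_perp_def by (auto simp: subspace_def sig_inner_simps)
qed

lemma V_Int_V_perp:
  assumes p: "p \<in> W" and x: "x \<in> V_space Y p" "x \<in> V_perp N Y p"
  shows "x = 0"
proof -
  obtain \<alpha> \<beta> \<gamma> \<delta> where e: "x = \<alpha> *\<^sub>R Y p + \<beta> *\<^sub>R d1 Y p + \<gamma> *\<^sub>R d2 Y p + \<delta> *\<^sub>R (d1 (d1 Y) p + d2 (d2 Y) p)"
    using x V_space_iff[OF p] by blast
  have "x \<odot> Y p = 0" "x \<odot> d1 Y p = 0" "x \<odot> d2 Y p = 0" "x \<odot> (d1 (d1 Y) p + d2 (d2 Y) p) = 0"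
    using x V_perp_iff[OF p] by auto
  then show ?thesis unfolding e by (simp add: sig_inner_simps frame_simps[OF p])
qed

lemma V_decompose:
  assumes p: "p \<in> W"
  obtains v where "v \<in> V_space Y p" "x - v \<in> V_perp N Y p"
proof
  define L where "L = d1 (d1 Y) p + d2 (d2 Y) p"
  define v where "v = ((- (x \<odot> Y p) / 2 * (L \<odot> L) - x \<odot> L) / 2) *\<^sub>R Y p + (x \<odot> d1 Y p) *\<^sub>R d1 Y p
      + (x \<odot> d2 Y p) *\<^sub>R d2 Y p + (- (x \<odot> Y p) / 2) *\<^sub>R L"
  have L: "L \<odot> Y p = -2" "L \<odot> d1 Y p = 0" "L \<odot> d2 Y p = 0" "Y p \<odot> L = -2" "d1 Y p \<odot> L = 0" "d2 Y p \<odot> L = 0"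
    unfolding L_def by (auto simp: sig_inner_simps frame_simps[OF p])
  show "v \<in> V_space Y p" unfolding V_space_iff[OF p] v_def L_def by blast
  show "x - v \<in> V_perp N Y p"
    unfolding V_perp_iff[OF p] L_def[symmetric] v_def
    by (simp add: sig_inner_simps L frame_simps[OF p]) (simp add: field_simps)
qed

text \<open>Reason: the imaginary part of \<open>Y\<^sub>z\<^sub>z\<close> is \<open>- Y\<^sub>1\<^sub>2 / 2\<close>.\<close>

lemma hopf_real_iff:
  assumes p: "p \<in> W"
  shows "hopf_differential N Y p \<in> range cvec \<longleftrightarrow> d1 (d2 Y) p \<in> span {Y p}"
proof -
  define L where "L = d1 (d1 Y) p + d2 (d2 Y) p"
  have L: "L \<odot> Y p = -2" "L \<odot> d1 Y p = 0" "L \<odot> d2 Y p = 0" "Y p \<odot> L = -2" "d1 Y p \<odot> L = 0" "d2 Y p \<odot> L = 0"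
    unfolding L_def by (auto simp: sig_inner_simps frame_simps[OF p])
  define s where "s = Complex (1/4 * ((d1 (d1 Y) p - d2 (d2 Y) p) \<odot> L)) (-1/2 * (d1 (d2 Y) p \<odot> L))"
  define Z where "Z = d_z (d_z (cfun Y)) p"
  have Z: "Re_vec Z = (1/4) *\<^sub>R (d1 (d1 Y) p - d2 (d2 Y) p)" "Im_vec Z = - (1/2) *\<^sub>R d1 (d2 Y) p"
    unfolding Z_def by (rule Re_Im_d_z_d_z[OF open_W smooth_Y p])+
  define k where "k = Z + (s/2) *s cvec (Y p)"
  have "hopf_differential N Y p = k"
    unfolding hopf_differential_def Z_def[symmetric]
  proof (rule the_equality)
    show "k \<in> complexify (V_perp N Y p) \<and> (\<exists>s. Z = - (s / 2) *s cvec (Y p) + k)"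
    proof
      show "k \<in> complexify (V_perp N Y p)"
        unfolding complexify_iff[OF subspace_V(2)] V_perp_iff[OF p] L_def[symmetric]
        by (simp add: k_def Z s_def sig_inner_simps L frame_simps[OF p])
      have "Z = - (s / 2) *s cvec (Y p) + k"
        by (rule Re_Im_vec_eqI) (auto simp: k_def)
      then show "\<exists>s. Z = - (s / 2) *s cvec (Y p) + k" by blast
    qed
    fix k' assume k': "k' \<in> complexify (V_perp N Y p) \<and> (\<exists>s. Z = - (s / 2) *s cvec (Y p) + k')"
    then obtain s' where s': "Z = - (s' / 2) *s cvec (Y p) + k'" by blast
    have R: "Re_vec k' = (1/4) *\<^sub>R (d1 (d1 Y) p - d2 (d2 Y) p) + (Re s' / 2) *\<^sub>R Y p"
      and I: "Im_vec k' = - (1/2) *\<^sub>R d1 (d2 Y) p + (Im s' / 2) *\<^sub>R Y p"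
      unfolding Z[symmetric] unfolding s' by auto
    have "Re_vec k' \<odot> L = 0" "Im_vec k' \<odot> L = 0"
      using k' unfolding complexify_iff[OF subspace_V(2)] V_perp_iff[OF p] L_def by auto
    then have "Re s' = Re s" "Im s' = Im s" unfolding R I by (auto simp: s_def sig_inner_simps L)
    then show "k' = k" unfolding k_def by (intro Re_Im_vec_eqI) (auto simp: R I Z)
  qed
  then have "hopf_differential N Y p \<in> range cvec \<longleftrightarrow> Im_vec k = 0" by (simp add: range_cvec_iff)
  also have "\<dots> \<longleftrightarrow> d1 (d2 Y) p = Im s *\<^sub>R Y p"
    by (auto simp: k_def Z vec_eq_iff)
  also have "\<dots> \<longleftrightarrow> d1 (d2 Y) p \<in> span {Y p}"
  proof
    assume "d1 (d2 Y) p \<in> span {Y p}"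
    then obtain t where t: "d1 (d2 Y) p = t *\<^sub>R Y p" by (auto simp: span_singleton)
    then have "Im s = t" by (simp add: s_def sig_inner_simps L)
    then show "d1 (d2 Y) p = Im s *\<^sub>R Y p" using t by simp
  qed (auto simp: span_singleton)
  finally show ?thesis .
qed

lemma normal_D_z_eq_0_iff:
  assumes p: "p \<in> W" and f: "f differentiable (at p)"
  shows "normal_D_z N Y f p = 0 \<longleftrightarrow> d1 f p \<in> V_space Y p \<and> d2 f p \<in> V_space Y p"
proof -
  define P where "P = (\<lambda>w. w \<in> complexify (V_perp N Y p) \<and> d_z (cfun f) p - w \<in> complexify (V_space Y p))"
  have P: "P w \<longleftrightarrow> Re_vec w \<in> V_perp N Y p \<and> Im_vec w \<in> V_perp N Y p \<and>
      (1/2) *\<^sub>R d1 f p - Re_vec w \<in> V_space Y p \<and> - (1/2) *\<^sub>R d2 f p - Im_vec w \<in> V_space Y p" for w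
    unfolding P_def complexify_iff[OF subspace_V(1)] complexify_iff[OF subspace_V(2)]
    by (auto simp: Re_Im_d_z_cfun[OF f])
  have uniq: "w = w'" if "P w" "P w'" for w w'
  proof (rule Re_Im_vec_eqI; rule right_minus_eq[THEN iffD1]; rule V_Int_V_perp[OF p])
    have "((1/2) *\<^sub>R d1 f p - Re_vec w') - ((1/2) *\<^sub>R d1 f p - Re_vec w) \<in> V_space Y p"
      "(- (1/2) *\<^sub>R d2 f p - Im_vec w') - (- (1/2) *\<^sub>R d2 f p - Im_vec w) \<in> V_space Y p"
      using that unfolding P by (blast intro: subspace_diff[OF subspace_V(1)])+
    then show "Re_vec w - Re_vec w' \<in> V_space Y p" "Im_vec w - Im_vec w' \<in> V_space Y p" by auto
    show "Re_vec w - Re_vec w' \<in> V_perp N Y p" "Im_vec w - Im_vec w' \<in> V_perp N Y p"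
      using that unfolding P by (auto intro: subspace_diff[OF subspace_V(2)])
  qed
  obtain v v' where v: "v \<in> V_space Y p" "d1 f p - v \<in> V_perp N Y p" "v' \<in> V_space Y p" "d2 f p - v' \<in> V_perp N Y p"
    using V_decompose[OF p] by metis
  have "(1/2) *\<^sub>R (d1 f p - v) \<in> V_perp N Y p" "(- 1/2) *\<^sub>R (d2 f p - v') \<in> V_perp N Y p"
    using v by (blast intro: subspace_scale[OF subspace_V(2)])+
  then have "P (cvec ((1/2) *\<^sub>R (d1 f p - v)) + \<i> *s cvec (- (1/2) *\<^sub>R (d2 f p - v')))"
    unfolding P using v by (simp add: subspace_scale[OF subspace_V(1)] scaleR_right_diff_distrib
        subspace_neg[OF subspace_V(1)])
  then have ex1: "\<exists>!w. P w" using uniq by blast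
  have "normal_D_z N Y f p = (THE w. P w)" unfolding normal_D_z_def P_def ..
  then have "normal_D_z N Y f p = 0 \<longleftrightarrow> P 0" using theI'[OF ex1] the1_equality[OF ex1] by metis
  also have "\<dots> \<longleftrightarrow> d1 f p \<in> V_space Y p \<and> d2 f p \<in> V_space Y p"
  proof -
    have "c *\<^sub>R x \<in> V_space Y p \<longleftrightarrow> x \<in> V_space Y p" if "c \<noteq> 0" for x and c :: real
      using subspace_scale[OF subspace_V(1), of x p c] subspace_scale[OF subspace_V(1), of "c *\<^sub>R x" p "1/c"] that by auto
    from this[of "1/2" "d1 f p"] this[of "-1/2" "d2 f p"]
    show ?thesis unfolding P using subspace_0[OF subspace_V(2)] by simp
  qed
  finally show ?thesis .
qed

end

lemma canonical_lift_on_iff: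
  assumes W: "open W"
  shows "canonical_lift_on N W y Y \<longleftrightarrow> conformal_frame N W Y \<and> (\<forall>p\<in>W. y p = span {Y p})"
proof
  assume c: "canonical_lift_on N W y Y"
  then have s: "smooth_on W Y" "\<And>p. p \<in> W \<Longrightarrow> y p = span {Y p}" "\<And>p. p \<in> W \<Longrightarrow> sig_inner N (Y p) (Y p) = 0"
    unfolding canonical_lift_on_def lift_on_def light_cone_def by auto
  have m: "sig_inner N (dder v Y p) (dder v Y p) = (norm v)\<^sup>2" if "p \<in> W" for v p
    using c that unfolding canonical_lift_on_def induced_metric_def dder_def by auto
  have "sig_inner N (d1 Y p) (d2 Y p) = 0" if p: "p \<in> W" for p
  proof -
    have "dder (1 + \<i>) Y p = d1 Y p + d2 Y p"
      using dder_decompose[OF smooth_on_differentiable[OF s(1) p], of "1 + \<i>"] by simp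
    moreover have "(norm (1 + \<i>))\<^sup>2 = 2" by (simp add: cmod_power2)
    ultimately show ?thesis using m[OF p, of "1 + \<i>"] m[OF p, of 1] m[OF p, of \<i>]
      by (simp add: sig_inner_simps sig_inner_commute)
  qed
  then show "conformal_frame N W Y \<and> (\<forall>p\<in>W. y p = span {Y p})"
    using s m[of _ 1] m[of _ \<i>] W by (auto simp: conformal_frame_def)
next
  assume c: "conformal_frame N W Y \<and> (\<forall>p\<in>W. y p = span {Y p})"
  then interpret conformal_frame N W Y by simp
  have "sig_inner N (dder v Y p) (dder v Y p) = (norm v)\<^sup>2" if p: "p \<in> W" for v p
    using dder_decompose[OF smooth_on_differentiable[OF smooth_Y p], of v]
    by (simp add: sig_inner_simps frame_simps[OF p] cmod_power2 flip: power2_eq_square)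
  then show "canonical_lift_on N W y Y" unfolding canonical_lift_on_def lift_on_def induced_metric_def dder_def[symmetric]
    using c smooth_Y Y_nonzero Y_Y by (auto simp: light_cone_def)
qed

section \<open>Darboux transforms and polar surfaces\<close>

lemma dder_scaleR:
  assumes "smooth_on D f" "smooth_on D g" "p \<in> D"
  shows "dder v (\<lambda>p. f p *\<^sub>R g p) p = f p *\<^sub>R dder v g p + dder v f p *\<^sub>R g p"
  by (rule dder_eq[OF bounded_bilinear.FDERIV[OF bounded_bilinear_scaleR smooth_on_has_derivative smooth_on_has_derivative]])
     (use assms in auto)

lemma dder_add:
  assumes "smooth_on D f" "smooth_on D g" "p \<in> D"
  shows "dder v (\<lambda>p. f p + g p) p = dder v f p + dder v g p"
  by (rule dder_eq[OF has_derivative_add[OF smooth_on_has_derivative smooth_on_has_derivative]])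
     (use assms in auto)

lemma dder_diff:
  assumes "smooth_on D f" "smooth_on D g" "p \<in> D"
  shows "dder v (\<lambda>p. f p - g p) p = dder v f p - dder v g p"
  by (rule dder_eq[OF has_derivative_diff[OF smooth_on_has_derivative smooth_on_has_derivative]])
     (use assms in auto)

lemma smooth_on_minus: "open D \<Longrightarrow> smooth_on D f \<Longrightarrow> smooth_on D (\<lambda>p. - f p)"
  by (rule smooth_on_bounded_linear[OF _ bounded_linear_minus[OF bounded_linear_ident]])

lemma smooth_on_diff:
  "open D \<Longrightarrow> smooth_on D f \<Longrightarrow> smooth_on D g \<Longrightarrow> smooth_on D (\<lambda>p. f p - g p)"
  using smooth_on_add[OF _ _ smooth_on_minus, of D f g] by simp

lemma dder_minus: "smooth_on D f \<Longrightarrow> p \<in> D \<Longrightarrow> dder v (\<lambda>p. - f p) p = - dder v f p"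
  by (rule dder_eq[OF has_derivative_minus[OF smooth_on_has_derivative]])

locale isothermic_frame = conformal_frame N W Y
  for N :: "'m::finite set" and W and Y :: "complex \<Rightarrow> real ^ 'm" +
  assumes mixed: "\<And>p. p \<in> W \<Longrightarrow> d1 (d2 Y) p \<in> span {Y p}"

text \<open>
  The last two assumptions are the real and imaginary parts of the Darboux equation with
  \<open>\<mu> = a - i b\<close>.
\<close>

locale darboux_frame = isothermic_frame N W Y
  for N :: "'m::finite set" and W and Y :: "complex \<Rightarrow> real ^ 'm" +
  fixes Z :: "complex \<Rightarrow> real ^ 'm" and \<theta> :: real
  assumes smooth_Z: "smooth_on W Z" and theta: "\<theta> \<noteq> 0"
    and Z_Z: "\<And>p. p \<in> W \<Longrightarrow> sig_inner N (Z p) (Z p) = 0"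
    and Y_Z: "\<And>p. p \<in> W \<Longrightarrow> sig_inner N (Y p) (Z p) = -1"
    and Z1_ex: "\<And>p. p \<in> W \<Longrightarrow> \<exists>a. d1 Z p = a *\<^sub>R Z p + \<theta> *\<^sub>R (d1 Y p + a *\<^sub>R Y p)"
    and Z2_ex: "\<And>p. p \<in> W \<Longrightarrow> \<exists>b. d2 Z p = b *\<^sub>R Z p - \<theta> *\<^sub>R (d2 Y p + b *\<^sub>R Y p)"
begin

definition a where "a p = Z p \<odot> d1 Y p"
definition b where "b p = Z p \<odot> d2 Y p"

lemma Z_Y: "p \<in> W \<Longrightarrow> Z p \<odot> Y p = -1"
  using Y_Z by (simp add: sig_inner_commute)

lemma smooth_ab: "smooth_on W a" "smooth_on W b"
  unfolding a_def[abs_def] b_def[abs_def]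
  by (intro smooth_on_sig_inner open_W smooth_Z smooth_on_dder smooth_Y)+

lemma Z1: assumes p: "p \<in> W" shows "d1 Z p = a p *\<^sub>R Z p + \<theta> *\<^sub>R (d1 Y p + a p *\<^sub>R Y p)"
proof -
  obtain a' where a': "d1 Z p = a' *\<^sub>R Z p + \<theta> *\<^sub>R (d1 Y p + a' *\<^sub>R Y p)" using Z1_ex[OF p] by blast
  have "Z p \<odot> d1 Y p = a'"
    using dder_sig_inner_const[where N=N, OF open_W smooth_Z smooth_Y Z_Y p, of 1]
    unfolding a' by (simp add: sig_inner_simps frame_simps[OF p] Z_Y[OF p])
  then show ?thesis using a' by (simp add: a_def)
qed

lemma Z2: assumes p: "p \<in> W" shows "d2 Z p = b p *\<^sub>R Z p - \<theta> *\<^sub>R (d2 Y p + b p *\<^sub>R Y p)"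
proof -
  obtain b' where b': "d2 Z p = b' *\<^sub>R Z p - \<theta> *\<^sub>R (d2 Y p + b' *\<^sub>R Y p)" using Z2_ex[OF p] by blast
  have "Z p \<odot> d2 Y p = b'"
    using dder_sig_inner_const[where N=N, OF open_W smooth_Z smooth_Y Z_Y p, of \<i>]
    unfolding b' by (simp add: sig_inner_simps frame_simps[OF p] Z_Y[OF p])
  then show ?thesis using b' by (simp add: b_def)
qed

lemma Z_frame:
  assumes p: "p \<in> W"
  shows "Z p \<odot> d1 Y p = a p" "d1 Y p \<odot> Z p = a p" "Z p \<odot> d2 Y p = b p" "d2 Y p \<odot> Z p = b p"
  by (auto simp: a_def b_def sig_inner_commute)

lemmas Z_simps = Z_Z Y_Z Z_Y Z_frame

lemma d1_d2_Z:
  assumes p: "p \<in> W"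
  shows "d1 (d2 Z) p \<in> span {Z p}"
proof -
  obtain \<sigma> where \<sigma>: "d1 (d2 Y) p = \<sigma> *\<^sub>R Y p" using mixed[OF p] by (auto simp: span_singleton)
  have b1: "d1 b p = a p * b p - \<sigma>"
  proof -
    have "d1 b p = Z p \<odot> d1 (d2 Y) p + d1 Z p \<odot> d2 Y p"
      unfolding b_def[abs_def] by (rule dder_sig_inner[OF smooth_Z smooth_Ys(2) p])
    then show ?thesis
      unfolding \<sigma> Z1[OF p] by (simp add: sig_inner_simps frame_simps[OF p] Z_simps[OF p])
  qed
  note sm = smooth_on_scaleR smooth_on_add smooth_on_diff smooth_on_dder smooth_ab smooth_Z smooth_Y open_W smooth_on_const
  have "d1 (d2 Z) p = d1 (\<lambda>p. b p *\<^sub>R Z p - \<theta> *\<^sub>R (d2 Y p + b p *\<^sub>R Y p)) p"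
    by (rule dder_cong[OF open_W p Z2])
  also have "\<dots> = b p *\<^sub>R d1 Z p + d1 b p *\<^sub>R Z p - \<theta> *\<^sub>R (d1 (d2 Y) p + (b p *\<^sub>R d1 Y p + d1 b p *\<^sub>R Y p))"
  proof -
    have 1: "d1 (\<lambda>p. b p *\<^sub>R Z p) p = b p *\<^sub>R d1 Z p + d1 b p *\<^sub>R Z p"
      by (rule dder_scaleR[OF smooth_ab(2) smooth_Z p])
    have 2: "d1 (\<lambda>p. b p *\<^sub>R Y p) p = b p *\<^sub>R d1 Y p + d1 b p *\<^sub>R Y p"
      by (rule dder_scaleR[OF smooth_ab(2) smooth_Y p])
    have 3: "d1 (\<lambda>p. d2 Y p + b p *\<^sub>R Y p) p = d1 (d2 Y) p + d1 (\<lambda>p. b p *\<^sub>R Y p) p"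
      by (rule dder_add[OF _ _ p]) (intro sm)+
    have 4: "d1 (\<lambda>p. \<theta> *\<^sub>R (d2 Y p + b p *\<^sub>R Y p)) p = \<theta> *\<^sub>R d1 (\<lambda>p. d2 Y p + b p *\<^sub>R Y p) p"
      by (rule dder_scaleR_const[OF smooth_on_differentiable[OF _ p]]) (intro sm)
    show ?thesis
      by (subst dder_diff[OF _ _ p]) (intro sm | simp only: 1 2 3 4)+
  qed
  also have "\<dots> = (2 * a p * b p - \<sigma>) *\<^sub>R Z p"
    unfolding Z1[OF p] b1 \<sigma> by (simp add: vec_eq_iff algebra_simps)
  finally show ?thesis by (simp add: span_scale span_base)
qed

lemma Z_conformal:
  assumes p: "p \<in> W"
  shows "d1 Z p \<odot> d1 Z p = \<theta>\<^sup>2" "d2 Z p \<odot> d2 Z p = \<theta>\<^sup>2" "d1 Z p \<odot> d2 Z p = 0"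
  unfolding Z1[OF p] Z2[OF p]
  by (simp_all add: sig_inner_simps frame_simps[OF p] Z_simps[OF p] power2_eq_square algebra_simps)

lemma isothermic_frame_Z: "isothermic_frame N W (\<lambda>p. (1 / \<bar>\<theta>\<bar>) *\<^sub>R Z p)"
proof
  have d: "dder v (\<lambda>p. (1 / \<bar>\<theta>\<bar>) *\<^sub>R Z p) p = (1 / \<bar>\<theta>\<bar>) *\<^sub>R dder v Z p" if "p \<in> W" for p v
    by (rule dder_scaleR_const[OF smooth_on_differentiable[OF smooth_Z that]])
  show "open W" by (rule open_W)
  show "smooth_on W (\<lambda>p. (1 / \<bar>\<theta>\<bar>) *\<^sub>R Z p)"
    by (intro smooth_on_scaleR open_W smooth_on_const smooth_Z)
  fix p assume p: "p \<in> W"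
  show "(1 / \<bar>\<theta>\<bar>) *\<^sub>R Z p \<odot> (1 / \<bar>\<theta>\<bar>) *\<^sub>R Z p = 0" by (simp add: sig_inner_simps Z_simps[OF p])
  have "(1 / \<bar>\<theta>\<bar>) * ((1 / \<bar>\<theta>\<bar>) * \<theta>\<^sup>2) = 1" using theta
    by (simp add: power2_eq_square field_simps)
  then show "d1 (\<lambda>p. (1 / \<bar>\<theta>\<bar>) *\<^sub>R Z p) p \<odot> d1 (\<lambda>p. (1 / \<bar>\<theta>\<bar>) *\<^sub>R Z p) p = 1"
    "d2 (\<lambda>p. (1 / \<bar>\<theta>\<bar>) *\<^sub>R Z p) p \<odot> d2 (\<lambda>p. (1 / \<bar>\<theta>\<bar>) *\<^sub>R Z p) p = 1"
    unfolding d[OF p] sig_inner_scaleR_left sig_inner_scaleR_right Z_conformal[OF p] by auto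
  show "d1 (\<lambda>p. (1 / \<bar>\<theta>\<bar>) *\<^sub>R Z p) p \<odot> d2 (\<lambda>p. (1 / \<bar>\<theta>\<bar>) *\<^sub>R Z p) p = 0"
    unfolding d[OF p] sig_inner_scaleR_left sig_inner_scaleR_right Z_conformal[OF p] by auto
  have "d1 (d2 (\<lambda>p. (1 / \<bar>\<theta>\<bar>) *\<^sub>R Z p)) p = d1 (\<lambda>p. (1 / \<bar>\<theta>\<bar>) *\<^sub>R d2 Z p) p"
    by (rule dder_cong[OF open_W p d])
  also have "\<dots> = (1 / \<bar>\<theta>\<bar>) *\<^sub>R d1 (d2 Z) p"
    by (rule dder_scaleR_const[OF smooth_on_differentiable[OF smooth_on_dder[OF smooth_Z] p]])
  finally show "d1 (d2 (\<lambda>p. (1 / \<bar>\<theta>\<bar>) *\<^sub>R Z p)) p \<in> span {(1 / \<bar>\<theta>\<bar>) *\<^sub>R Z p}"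
    using d1_d2_Z[OF p] theta by (auto simp: span_singleton image_iff)
qed

end

locale polar_frame = isothermic_frame N W Y
  for N :: "'m::finite set" and W and Y :: "complex \<Rightarrow> real ^ 'm" +
  fixes \<psi> :: "complex \<Rightarrow> real ^ 'm" and c :: real
  assumes smooth_psi: "smooth_on W \<psi>"
    and psi_psi: "\<And>p. p \<in> W \<Longrightarrow> sig_inner N (\<psi> p) (\<psi> p) = c"
    and psi_perp: "\<And>p. p \<in> W \<Longrightarrow> \<psi> p \<in> V_perp N Y p"
    and d_psi_V: "\<And>p. p \<in> W \<Longrightarrow> d1 \<psi> p \<in> V_space Y p" "\<And>p. p \<in> W \<Longrightarrow> d2 \<psi> p \<in> V_space Y p"
begin

definition k where "k p = \<psi> p \<odot> d1 (d1 Y) p"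

lemma smooth_k: "smooth_on W k"
  unfolding k_def[abs_def] by (intro smooth_on_sig_inner open_W smooth_psi smooth_on_dder smooth_Y)

lemma psi_frame:
  assumes p: "p \<in> W"
  shows "\<psi> p \<odot> Y p = 0" "\<psi> p \<odot> d1 Y p = 0" "\<psi> p \<odot> d2 Y p = 0"
    "\<psi> p \<odot> d1 (d1 Y) p = k p" "\<psi> p \<odot> d2 (d2 Y) p = - k p" "\<psi> p \<odot> d1 (d2 Y) p = 0"
proof -
  show "\<psi> p \<odot> Y p = 0" "\<psi> p \<odot> d1 Y p = 0" "\<psi> p \<odot> d2 Y p = 0"
    "\<psi> p \<odot> d1 (d1 Y) p = k p" "\<psi> p \<odot> d2 (d2 Y) p = - k p"
    using psi_perp[OF p] unfolding V_perp_iff[OF p] by (auto simp: k_def sig_inner_simps)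
  then show "\<psi> p \<odot> d1 (d2 Y) p = 0"
    using mixed[OF p] by (auto simp: span_singleton sig_inner_simps)
qed

lemma d_psi_frame:
  assumes p: "p \<in> W"
  shows "d1 \<psi> p \<odot> Y p = 0" "d1 \<psi> p \<odot> d1 Y p = - k p" "d1 \<psi> p \<odot> d2 Y p = 0"
    "d2 \<psi> p \<odot> Y p = 0" "d2 \<psi> p \<odot> d1 Y p = 0" "d2 \<psi> p \<odot> d2 Y p = k p"
proof -
  note C = dder_sig_inner_const[where N=N, OF open_W smooth_psi _ _ p]
  show "d1 \<psi> p \<odot> Y p = 0" "d2 \<psi> p \<odot> Y p = 0"
    using C[OF smooth_Ys(1) psi_frame(1), of 1] C[OF smooth_Ys(1) psi_frame(1), of \<i>] psi_frame[OF p] by auto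
  show "d1 \<psi> p \<odot> d1 Y p = - k p" "d2 \<psi> p \<odot> d1 Y p = 0"
    using C[OF smooth_Ys(2) psi_frame(2), of 1] C[OF smooth_Ys(2) psi_frame(2), of \<i>] psi_frame[OF p] d2_d1_Y[OF p] by auto
  show "d1 \<psi> p \<odot> d2 Y p = 0" "d2 \<psi> p \<odot> d2 Y p = k p"
    using C[OF smooth_Ys(2) psi_frame(3), of 1] C[OF smooth_Ys(2) psi_frame(3), of \<i>] psi_frame[OF p] by auto
qed

lemma d_psi:
  assumes p: "p \<in> W"
  shows "d1 \<psi> p = d1 k p *\<^sub>R Y p - k p *\<^sub>R d1 Y p" "d2 \<psi> p = k p *\<^sub>R d2 Y p - d2 k p *\<^sub>R Y p"
proof -
  obtain \<sigma> where \<sigma>: "d1 (d2 Y) p = \<sigma> *\<^sub>R Y p" using mixed[OF p] by (auto simp: span_singleton)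
  have comm: "d2 (d1 \<psi>) p = d1 (d2 \<psi>) p" by (rule dder_commute[OF open_W p smooth_psi])
  have C: "sig_inner N (f p) (dder v g p) + sig_inner N (dder v f p) (g p) = dder v h p"
    if "smooth_on W f" "smooth_on W g" "\<And>p. p \<in> W \<Longrightarrow> f p \<odot> g p = h p" for f g h v
    using dder_sig_inner[OF that(1,2) p, where v=v and N=N] dder_cong[OF open_W p that(3), where v=v] by simp
  note sp = smooth_on_dder[OF smooth_psi]
  have "d1 \<psi> p \<odot> d2 (d2 Y) p = - d1 k p"
    using C[OF sp smooth_Ys(2) d_psi_frame(6), of 1] dder_sig_inner_const[where N=N, OF open_W sp smooth_Ys(2) d_psi_frame(3) p, of \<i>]
    by (simp add: \<sigma> comm sig_inner_simps d_psi_frame[OF p])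
  moreover obtain \<alpha> \<beta> \<gamma> \<delta> where e: "d1 \<psi> p = \<alpha> *\<^sub>R Y p + \<beta> *\<^sub>R d1 Y p + \<gamma> *\<^sub>R d2 Y p + \<delta> *\<^sub>R (d1 (d1 Y) p + d2 (d2 Y) p)"
    using d_psi_V(1)[OF p] V_space_iff[OF p] by blast
  moreover have "\<delta> = 0" "\<beta> = - k p" "\<gamma> = 0"
    using d_psi_frame(1-3)[OF p] unfolding e by (auto simp: sig_inner_simps frame_simps[OF p])
  ultimately show "d1 \<psi> p = d1 k p *\<^sub>R Y p - k p *\<^sub>R d1 Y p"
    by (simp add: sig_inner_simps frame_simps[OF p])
  have "d2 \<psi> p \<odot> d1 (d1 Y) p = d2 k p"
    using C[OF sp smooth_Ys(2) d_psi_frame(2), of \<i>] dder_sig_inner_const[where N=N, OF open_W sp smooth_Ys(2) d_psi_frame(5) p, of 1]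
    by (simp add: \<sigma> comm d2_d1_Y[OF p] sig_inner_simps d_psi_frame[OF p] dder_minus[OF smooth_k p])
  moreover obtain \<alpha> \<beta> \<gamma> \<delta> where e: "d2 \<psi> p = \<alpha> *\<^sub>R Y p + \<beta> *\<^sub>R d1 Y p + \<gamma> *\<^sub>R d2 Y p + \<delta> *\<^sub>R (d1 (d1 Y) p + d2 (d2 Y) p)"
    using d_psi_V(2)[OF p] V_space_iff[OF p] by blast
  moreover have "\<delta> = 0" "\<beta> = 0" "\<gamma> = k p"
    using d_psi_frame(4-6)[OF p] unfolding e by (auto simp: sig_inner_simps frame_simps[OF p])
  ultimately have "- \<alpha> = d2 k p" "d2 \<psi> p = \<alpha> *\<^sub>R Y p + k p *\<^sub>R d2 Y p"
    by (auto simp: sig_inner_simps frame_simps[OF p])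
  then show "d2 \<psi> p = k p *\<^sub>R d2 Y p - d2 k p *\<^sub>R Y p" by (metis add.commute diff_minus_eq_add minus_diff_eq scaleR_minus_left uminus_add_conv_diff)
qed

lemma dder_d_psi:
  assumes p: "p \<in> W"
  shows "dder v (d1 \<psi>) p = dder v (d1 k) p *\<^sub>R Y p + d1 k p *\<^sub>R dder v Y p - k p *\<^sub>R dder v (d1 Y) p - dder v k p *\<^sub>R d1 Y p"
    "dder v (d2 \<psi>) p = k p *\<^sub>R dder v (d2 Y) p + dder v k p *\<^sub>R d2 Y p - dder v (d2 k) p *\<^sub>R Y p - d2 k p *\<^sub>R dder v Y p"
proof -
  have a: "dder v (\<lambda>p. dder w k p *\<^sub>R Y p) p = dder w k p *\<^sub>R dder v Y p + dder v (dder w k) p *\<^sub>R Y p"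
    "dder v (\<lambda>p. k p *\<^sub>R dder w Y p) p = k p *\<^sub>R dder v (dder w Y) p + dder v k p *\<^sub>R dder w Y p" for w
    by (rule dder_scaleR[OF _ _ p]; intro smooth_on_dder smooth_k smooth_Y)+
  have s: "smooth_on W (\<lambda>p. dder w k p *\<^sub>R Y p)" "smooth_on W (\<lambda>p. k p *\<^sub>R dder w Y p)" for w
    by (intro smooth_on_scaleR open_W smooth_on_dder smooth_k smooth_Y)+
  show "dder v (d1 \<psi>) p = dder v (d1 k) p *\<^sub>R Y p + d1 k p *\<^sub>R dder v Y p - k p *\<^sub>R dder v (d1 Y) p - dder v k p *\<^sub>R d1 Y p"
    by (subst dder_cong[OF open_W p d_psi(1)], assumption) (simp add: dder_diff[OF s p] a)
  show "dder v (d2 \<psi>) p = k p *\<^sub>R dder v (d2 Y) p + dder v k p *\<^sub>R d2 Y p - dder v (d2 k) p *\<^sub>R Y p - d2 k p *\<^sub>R dder v Y p"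
    by (subst dder_cong[OF open_W p d_psi(2)], assumption) (simp add: dder_diff[OF s(2,1) p] a)
qed

lemma d1_d2_k:
  assumes p: "p \<in> W"
  shows "d1 (d2 k) p *\<^sub>R Y p = k p *\<^sub>R d1 (d2 Y) p"
proof -
  have "d2 (d1 \<psi>) p = d1 (d2 \<psi>) p" by (rule dder_commute[OF open_W p smooth_psi])
  moreover have "d2 (d1 k) p = d1 (d2 k) p" by (rule dder_commute_real[OF open_W p smooth_k])
  ultimately show ?thesis unfolding dder_d_psi[OF p] d2_d1_Y[OF p] by (simp add: vec_eq_iff mult.commute)
qed

end

lemma dder_inverse:
  fixes f :: "complex \<Rightarrow> real"
  assumes "smooth_on D f" "p \<in> D" "f p \<noteq> 0"
  shows "dder v (\<lambda>p. c / f p) p = - c * dder v f p / (f p)\<^sup>2"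
  by (rule dder_eq)
     (auto intro!: derivative_eq_intros smooth_on_has_derivative[OF assms(1,2)] simp: assms(3) field_simps power2_eq_square)

lemma dder_sum3:
  assumes "smooth_on D u" "smooth_on D f" "smooth_on D x" "smooth_on D h" "smooth_on D y" "p \<in> D"
  shows "dder v (\<lambda>p. u p + f p *\<^sub>R x p + h p *\<^sub>R y p) p =
    dder v u p + (f p *\<^sub>R dder v x p + dder v f p *\<^sub>R x p) + (h p *\<^sub>R dder v y p + dder v h p *\<^sub>R y p)"
  by (rule dder_eq)
     (use assms in \<open>intro has_derivative_add bounded_bilinear.FDERIV[OF bounded_bilinear_scaleR]
        smooth_on_has_derivative; auto\<close>)

lemma darboux_identity:
  fixes \<theta> g k :: real
  assumes "\<theta> \<noteq> 0" "g \<noteq> 0" "k \<noteq> 0" and g1: "g1 = a * g - k * a - k1"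
    and A: "A = a + k1 / k - g1 / g"
  shows "(- \<theta> / g) * (g * (y1 + a * y) + ((k1 + k * a) / \<theta>) * z) + (\<theta> * g1 / g\<^sup>2) * (P + g * y + (k / \<theta>) * z)
    = A * ((- \<theta> / g) * (P + g * y + (k / \<theta>) * z))
      + \<theta> * ((1 / k) * (k1 * y - k * y1) + (- k1 / k\<^sup>2) * P + A * ((1 / k) * P))"
proof -
  have k1: "k1 = a * g - k * a - g1" using g1 by simp
  show ?thesis unfolding A k1 using assms(1-3)
    by (simp add: field_simps power2_eq_square)
qed

lemma darboux_identity':
  fixes \<theta> g k :: real
  assumes "\<theta> \<noteq> 0" "g \<noteq> 0" "k \<noteq> 0" and g2: "g2 = b * g + k * b + k2"
    and B: "B = b + k2 / k - g2 / g"
  shows "(- \<theta> / g) * (g * (y2 + b * y) + ((k2 + k * b) / \<theta>) * z) + (\<theta> * g2 / g\<^sup>2) * (P + g * y + (k / \<theta>) * z)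
    = B * ((- \<theta> / g) * (P + g * y + (k / \<theta>) * z))
      - \<theta> * ((1 / k) * (k * y2 - k2 * y) + (- k2 / k\<^sup>2) * P + B * ((1 / k) * P))"
proof -
  have k2: "k2 = g2 - b * g - k * b" using g2 by simp
  show ?thesis unfolding B k2 using assms(1-3)
    by (simp add: field_simps power2_eq_square)
qed

locale polar_darboux = darboux_frame N W Y Z \<theta> + polar_frame N W Y \<psi> c
  for N :: "'m::finite set" and W and Y Z :: "complex \<Rightarrow> real ^ 'm" and \<theta> and \<psi> and c +
  assumes k_nonzero: "\<And>p. p \<in> W \<Longrightarrow> k p \<noteq> 0"
begin

definition g where "g p = \<psi> p \<odot> Z p"

definition \<phi> where "\<phi> p = \<psi> p + g p *\<^sub>R Y p + (k p / \<theta>) *\<^sub>R Z p"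

lemma smooth_g: "smooth_on W g"
  unfolding g_def[abs_def] by (intro smooth_on_sig_inner open_W smooth_psi smooth_Z)

lemma smooth_k_theta: "smooth_on W (\<lambda>p. k p / \<theta>)"
  by (intro smooth_on_divide open_W smooth_k smooth_on_const theta)

lemma smooth_phi: "smooth_on W \<phi>"
  unfolding \<phi>_def[abs_def]
  by (intro smooth_on_add smooth_on_scaleR open_W smooth_psi smooth_g smooth_k_theta smooth_Y smooth_Z)

lemma d_g:
  assumes p: "p \<in> W"
  shows "d1 g p = a p * g p - k p * a p - d1 k p" "d2 g p = b p * g p + k p * b p + d2 k p"
proof -
  have "dder v g p = \<psi> p \<odot> dder v Z p + dder v \<psi> p \<odot> Z p" for v
    unfolding g_def[abs_def] by (rule dder_sig_inner[OF smooth_psi smooth_Z p])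
  then show "d1 g p = a p * g p - k p * a p - d1 k p" "d2 g p = b p * g p + k p * b p + d2 k p"
    by (auto simp: Z1[OF p] Z2[OF p] d_psi[OF p] sig_inner_simps psi_frame[OF p] Z_simps[OF p] g_def[symmetric])
qed

lemma d_phi:
  assumes p: "p \<in> W"
  shows "d1 \<phi> p = g p *\<^sub>R (d1 Y p + a p *\<^sub>R Y p) + ((d1 k p + k p * a p) / \<theta>) *\<^sub>R Z p"
    "d2 \<phi> p = g p *\<^sub>R (d2 Y p + b p *\<^sub>R Y p) + ((d2 k p + k p * b p) / \<theta>) *\<^sub>R Z p"
proof -
  have k: "dder v (\<lambda>p. k p / \<theta>) p = dder v k p / \<theta>" for v
    using dder_scaleR_const[OF smooth_on_differentiable[OF smooth_k p], of v "1/\<theta>"] by simp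
  have "dder v \<phi> p = dder v \<psi> p + (g p *\<^sub>R dder v Y p + dder v g p *\<^sub>R Y p)
      + ((k p / \<theta>) *\<^sub>R dder v Z p + (dder v k p / \<theta>) *\<^sub>R Z p)" for v
    unfolding \<phi>_def[abs_def] dder_sum3[OF smooth_psi smooth_g smooth_Y smooth_k_theta smooth_Z p] k ..
  then show "d1 \<phi> p = g p *\<^sub>R (d1 Y p + a p *\<^sub>R Y p) + ((d1 k p + k p * a p) / \<theta>) *\<^sub>R Z p"
    "d2 \<phi> p = g p *\<^sub>R (d2 Y p + b p *\<^sub>R Y p) + ((d2 k p + k p * b p) / \<theta>) *\<^sub>R Z p"
    using theta by (auto simp: Z1[OF p] Z2[OF p] d_psi[OF p] d_g[OF p] vec_eq_iff field_simps)
qed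

lemma phi_simps:
  assumes p: "p \<in> W"
  shows "\<phi> p \<odot> Y p = - k p / \<theta>" "\<phi> p \<odot> Z p = 0" "\<phi> p \<odot> \<phi> p = c"
    "\<phi> p \<odot> d1 Z p = 0" "\<phi> p \<odot> d2 Z p = 0" "\<psi> p \<odot> \<phi> p = c + k p * g p / \<theta>"
  unfolding \<phi>_def Z1[OF p] Z2[OF p]
  by (auto simp: sig_inner_simps psi_frame[OF p] Z_simps[OF p] frame_simps[OF p] psi_psi[OF p]
      sig_inner_commute[of N "Y p" "\<psi> p"] sig_inner_commute[of N "Z p" "\<psi> p"] sig_inner_commute[of N "Y p" "Z p"]
      g_def[symmetric] algebra_simps)

lemma phi_nonzero: "p \<in> W \<Longrightarrow> \<phi> p \<noteq> 0"
  using phi_simps(1)[of p] k_nonzero[of p] theta by (auto simp: sig_inner_simps)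

lemma d_psi_d_Z:
  assumes p: "p \<in> W"
  shows "dder v \<psi> p + (k p / \<theta>) *\<^sub>R dder v Z p \<in> span {Y p, Z p}"
proof -
  have 1: "d1 \<psi> p + (k p / \<theta>) *\<^sub>R d1 Z p = (d1 k p + k p * a p) *\<^sub>R Y p + (k p / \<theta> * a p) *\<^sub>R Z p"
    "d2 \<psi> p + (k p / \<theta>) *\<^sub>R d2 Z p = (- d2 k p - k p * b p) *\<^sub>R Y p + (k p / \<theta> * b p) *\<^sub>R Z p"
    using theta by (auto simp: d_psi[OF p] Z1[OF p] Z2[OF p] vec_eq_iff field_simps)
  have "dder v \<psi> p + (k p / \<theta>) *\<^sub>R dder v Z p
      = Re v *\<^sub>R (d1 \<psi> p + (k p / \<theta>) *\<^sub>R d1 Z p) + Im v *\<^sub>R (d2 \<psi> p + (k p / \<theta>) *\<^sub>R d2 Z p)"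
    unfolding dder_decompose[OF smooth_on_differentiable[OF smooth_psi p], of v]
      dder_decompose[OF smooth_on_differentiable[OF smooth_Z p], of v]
    by (simp add: vec_eq_iff algebra_simps)
  also have "\<dots> \<in> span {Y p, Z p}" unfolding 1
    by (intro span_add span_scale span_base) auto
  finally show ?thesis .
qed

lemma d1_Z_notin_span:
  assumes p: "p \<in> W"
  shows "d1 Z p \<notin> span {Y p, Z p}"
proof
  assume "d1 Z p \<in> span {Y p, Z p}"
  then obtain u w where e: "d1 Z p = u *\<^sub>R Y p + w *\<^sub>R Z p"
    by (auto simp: span_breakdown_eq span_singleton diff_eq_eq add.commute)
  have "\<theta>\<^sup>2 = d1 Z p \<odot> d1 Z p" using Z_conformal(1)[OF p] by simp
  also have "\<dots> = 2 * u * w * (-1)" unfolding e by (simp add: sig_inner_simps Z_simps[OF p] frame_simps[OF p])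
  finally have "\<theta>\<^sup>2 = - 2 * u * w" by simp
  moreover have "d1 Z p \<odot> Z p = 0"
    using dder_sig_inner_const[where N=N, OF open_W smooth_Z smooth_Z Z_Z p, of 1] by (simp add: sig_inner_commute)
  then have "u = 0" unfolding e by (simp add: sig_inner_simps Z_simps[OF p])
  ultimately show False using theta by simp
qed

lemma polar_frame_phi: "polar_frame N W (\<lambda>p. (1 / \<bar>\<theta>\<bar>) *\<^sub>R Z p) \<phi> c"
proof -
  define F where "F = (\<lambda>p. (1 / \<bar>\<theta>\<bar>) *\<^sub>R Z p)"
  interpret F: isothermic_frame N W F unfolding F_def by (rule isothermic_frame_Z)
  have dF: "dder v F p = (1 / \<bar>\<theta>\<bar>) *\<^sub>R dder v Z p" if "p \<in> W" for p v
    unfolding F_def by (rule dder_scaleR_const[OF smooth_on_differentiable[OF smooth_Z that]])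
  have phi: "sig_inner N (\<phi> p) (F p) = 0" "sig_inner N (\<phi> p) (d1 F p) = 0" "sig_inner N (\<phi> p) (d2 F p) = 0" if "p \<in> W" for p
    unfolding dF[OF that] unfolding F_def by (auto simp: sig_inner_simps phi_simps[OF that])
  have "polar_frame N W F \<phi> c"
  proof
    show "smooth_on W \<phi>" by (rule smooth_phi)
    fix p assume p: "p \<in> W"
    show "sig_inner N (\<phi> p) (\<phi> p) = c" by (rule phi_simps[OF p])
    have e: "d1 Y p + a p *\<^sub>R Y p = (1 / \<theta>) *\<^sub>R (d1 Z p - a p *\<^sub>R Z p)"
      "d2 Y p + b p *\<^sub>R Y p = (1 / \<theta>) *\<^sub>R (b p *\<^sub>R Z p - d2 Z p)"
      using theta by (auto simp: Z1[OF p] Z2[OF p])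
    have V: "F p \<in> V_space F p" "d1 F p \<in> V_space F p" "d2 F p \<in> V_space F p"
      unfolding F.V_space_eq[OF p] by (auto intro: span_base)
    have z: "Z p = \<bar>\<theta>\<bar> *\<^sub>R F p" "dder v Z p = \<bar>\<theta>\<bar> *\<^sub>R dder v F p" for v
      unfolding dF[OF p] using theta by (auto simp: F_def)
    show "d1 \<phi> p \<in> V_space F p" "d2 \<phi> p \<in> V_space F p"
      unfolding d_phi[OF p] e z
      by (intro subspace_add[OF F.subspace_V(1)] subspace_scale[OF F.subspace_V(1)]
          subspace_diff[OF F.subspace_V(1)] V)+
    have "sig_inner N (\<phi> p) (d1 (d1 F) p) = - (sig_inner N (d1 \<phi> p) (d1 F p))"
      using dder_sig_inner_const[where N=N, OF open_W smooth_phi smooth_on_dder[OF F.smooth_Y] phi(2) p, of 1] by simp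
    moreover have "sig_inner N (\<phi> p) (d2 (d2 F) p) = - (sig_inner N (d2 \<phi> p) (d2 F p))"
      using dder_sig_inner_const[where N=N, OF open_W smooth_phi smooth_on_dder[OF F.smooth_Y] phi(3) p, of \<i>] by simp
    moreover have "sig_inner N (d1 \<phi> p) (d1 F p) + sig_inner N (d2 \<phi> p) (d2 F p) = 0"
      unfolding d_phi[OF p] e z
      by (simp add: sig_inner_simps F.frame_simps[OF p])
    ultimately have "sig_inner N (\<phi> p) ((d1 (d1 F) p + d2 (d2 F) p)) = 0"
      by (simp add: sig_inner_simps)
    then show "\<phi> p \<in> V_perp N F p" unfolding F.V_perp_iff[OF p] using phi[OF p] by auto
  qed
  then show ?thesis unfolding F_def .
qed

text \<open>
  For \<open>c = 0\<close> take \<open>\<iota>\<close> the identity and \<open>e = 0\<close>; for \<open>c \<noteq> 0\<close> the map \<open>x \<mapsto> \<iota> x + e\<close> is the embedding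
  into the light cone of the space with one more coordinate.
\<close>

lemma darboux_frame_phi:
  fixes \<iota> :: "real ^ 'm \<Rightarrow> real ^ 'k::finite" and N' and e
  assumes g: "\<And>p. p \<in> W \<Longrightarrow> g p \<noteq> 0"
    and lin: "linear \<iota>"
    and iso: "\<And>x y. sig_inner N' (\<iota> x) (\<iota> y) = sig_inner N x y"
    and orth: "\<And>x. sig_inner N' (\<iota> x) e = 0"
    and e: "sig_inner N' e e = - c"
  shows "darboux_frame N' W (\<lambda>p. (1 / k p) *\<^sub>R (\<iota> (\<psi> p) + e)) (\<lambda>p. (- \<theta> / g p) *\<^sub>R (\<iota> (\<phi> p) + e)) \<theta>"
proof -
  define X where "X = (\<lambda>p. (1 / k p) *\<^sub>R (\<iota> (\<psi> p) + e))"
  define X' where "X' = (\<lambda>p. (- \<theta> / g p) *\<^sub>R (\<iota> (\<phi> p) + e))"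
  have bl: "bounded_linear \<iota>" using lin linear_conv_bounded_linear by blast
  have orth': "sig_inner N' e (\<iota> x) = 0" for x using orth sig_inner_commute by metis
  have sm: "smooth_on W (\<lambda>p. \<iota> (f p))" if "smooth_on W f" for f
    by (rule smooth_on_bounded_linear[OF open_W bl that])
  have sme: "smooth_on W (\<lambda>p. \<iota> (f p) + e)" if "smooth_on W f" for f
    by (intro smooth_on_add open_W sm that smooth_on_const)
  have di: "dder v (\<lambda>p. \<iota> (f p)) p = \<iota> (dder v f p)" if "smooth_on W f" "p \<in> W" for f p v
    by (rule bounded_linear_dder[OF open_W that(2,1) bl])
  have die: "dder v (\<lambda>p. \<iota> (f p) + e) p = \<iota> (dder v f p)" if "smooth_on W f" "p \<in> W" for f p v
    using dder_add[OF sm[OF that(1)] smooth_on_const that(2), where v=v] di[OF that, where v=v] by (simp add: dder_const)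
  have s1k: "smooth_on W (\<lambda>p. 1 / k p)"
    by (intro smooth_on_divide open_W smooth_on_const smooth_k k_nonzero)
  have sg: "smooth_on W (\<lambda>p. - \<theta> / g p)"
    by (intro smooth_on_divide open_W smooth_on_const smooth_g g)
  have sX: "smooth_on W X" unfolding X_def by (intro smooth_on_scaleR open_W s1k sme smooth_psi)
  have sX': "smooth_on W X'" unfolding X'_def by (intro smooth_on_scaleR open_W sg sme smooth_phi)
  have dX: "dder v X p = (1 / k p) *\<^sub>R \<iota> (dder v \<psi> p) + (- dder v k p / (k p)\<^sup>2) *\<^sub>R (\<iota> (\<psi> p) + e)" if "p \<in> W" for v p
    unfolding X_def dder_scaleR[OF s1k sme[OF smooth_psi] that] die[OF smooth_psi that]
      dder_inverse[OF smooth_k that k_nonzero[OF that]] by simp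
  have dX': "dder v X' p = (- \<theta> / g p) *\<^sub>R \<iota> (dder v \<phi> p) + (\<theta> * dder v g p / (g p)\<^sup>2) *\<^sub>R (\<iota> (\<phi> p) + e)" if "p \<in> W" for v p
    unfolding X'_def dder_scaleR[OF sg sme[OF smooth_phi] that] die[OF smooth_phi that]
      dder_inverse[OF smooth_g that g[OF that]] by simp
  note lin_simps = linear_add[OF lin] linear_diff[OF lin] linear_scale[OF lin]
  have "darboux_frame N' W X X' \<theta>"
  proof
    show "open W" by (rule open_W)
    show "smooth_on W X" by (rule sX)
    show "smooth_on W X'" by (rule sX')
    show "\<theta> \<noteq> 0" by (rule theta)
    fix p assume p: "p \<in> W"
    have psi: "\<psi> p \<odot> dder v \<psi> p = 0" "dder v \<psi> p \<odot> \<psi> p = 0" for v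
      using dder_sig_inner_const[where N=N, OF open_W smooth_psi smooth_psi psi_psi p, of v] by (auto simp: sig_inner_commute)
    have PP: "sig_inner N' (\<iota> (\<psi> p) + e) (\<iota> (\<psi> p) + e) = 0"
      by (simp add: sig_inner_simps iso orth orth' e psi_psi[OF p])
    show "sig_inner N' (X p) (X p) = 0"
      unfolding X_def by (simp add: sig_inner_scaleR_left sig_inner_scaleR_right PP)
    have FF: "sig_inner N' (\<iota> (\<phi> p) + e) (\<iota> (\<phi> p) + e) = 0"
      by (simp add: sig_inner_simps iso orth orth' e phi_simps[OF p])
    show "sig_inner N' (X' p) (X' p) = 0"
      unfolding X'_def sig_inner_scaleR_left sig_inner_scaleR_right FF by simp
    have PF: "sig_inner N' (\<iota> (\<psi> p) + e) (\<iota> (\<phi> p) + e) = k p * g p / \<theta>"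
      by (simp add: sig_inner_simps iso orth orth' e phi_simps[OF p])
    show "sig_inner N' (X p) (X' p) = - 1"
      unfolding X_def X'_def sig_inner_scaleR_left sig_inner_scaleR_right PF
      using k_nonzero[OF p] g[OF p] theta by simp
    have dd: "sig_inner N' (dder v X p) (dder w X p) = (dder v \<psi> p \<odot> dder w \<psi> p) / (k p)\<^sup>2" for v w
    proof -
      define Q where "Q = \<iota> (\<psi> p) + e"
      have "sig_inner N' (\<iota> (dder v \<psi> p)) Q = 0" "sig_inner N' Q (\<iota> (dder v \<psi> p)) = 0" for v
        unfolding Q_def by (auto simp: sig_inner_simps iso orth orth' psi)
      then show ?thesis unfolding dX[OF p] Q_def[symmetric]
        by (simp add: sig_inner_simps PP[folded Q_def] iso power2_eq_square)
    qed
    show "sig_inner N' (d1 X p) (d1 X p) = 1" "sig_inner N' (d2 X p) (d2 X p) = 1" "sig_inner N' (d1 X p) (d2 X p) = 0"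
      unfolding dd d_psi[OF p] using k_nonzero[OF p] by (auto simp: sig_inner_simps frame_simps[OF p] power2_eq_square)
    show "d1 (d2 X) p \<in> span {X p}"
    proof -
      define h where "h = (\<lambda>p. - d2 k p / (k p)\<^sup>2)"
      have sh: "smooth_on W h" unfolding h_def power2_eq_square
        using k_nonzero by (intro smooth_on_divide open_W smooth_on_minus smooth_on_dder smooth_k smooth_on_mult) auto
      have "d1 (d2 X) p = d1 (\<lambda>p. (1 / k p) *\<^sub>R \<iota> (d2 \<psi> p) + h p *\<^sub>R (\<iota> (\<psi> p) + e)) p"
        unfolding h_def by (rule dder_cong[OF open_W p dX])
      also have "\<dots> = d1 (\<lambda>p. (1 / k p) *\<^sub>R \<iota> (d2 \<psi> p)) p + d1 (\<lambda>p. h p *\<^sub>R (\<iota> (\<psi> p) + e)) p"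
        by (rule dder_add[OF _ _ p]) (intro smooth_on_scaleR open_W s1k sm sh sme smooth_psi smooth_on_dder)+
      also have "d1 (\<lambda>p. (1 / k p) *\<^sub>R \<iota> (d2 \<psi> p)) p = (1 / k p) *\<^sub>R \<iota> (d1 (d2 \<psi>) p) + (- d1 k p / (k p)\<^sup>2) *\<^sub>R \<iota> (d2 \<psi> p)"
        unfolding dder_scaleR[OF s1k sm[OF smooth_on_dder[OF smooth_psi]] p] di[OF smooth_on_dder[OF smooth_psi] p]
          dder_inverse[OF smooth_k p k_nonzero[OF p]] by simp
      also have "d1 (\<lambda>p. h p *\<^sub>R (\<iota> (\<psi> p) + e)) p = h p *\<^sub>R \<iota> (d1 \<psi> p) + d1 h p *\<^sub>R (\<iota> (\<psi> p) + e)"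
        unfolding dder_scaleR[OF sh sme[OF smooth_psi] p] die[OF smooth_psi p] ..
      also have "(1 / k p) *\<^sub>R \<iota> (d1 (d2 \<psi>) p) + (- d1 k p / (k p)\<^sup>2) *\<^sub>R \<iota> (d2 \<psi> p) + (h p *\<^sub>R \<iota> (d1 \<psi> p) + d1 h p *\<^sub>R (\<iota> (\<psi> p) + e))
        = \<iota> ((1 / k p) *\<^sub>R d1 (d2 \<psi>) p + (- d1 k p / (k p)\<^sup>2) *\<^sub>R d2 \<psi> p + h p *\<^sub>R d1 \<psi> p) + d1 h p *\<^sub>R (\<iota> (\<psi> p) + e)"
        by (simp only: lin_simps add.assoc)
      also have "(1 / k p) *\<^sub>R d1 (d2 \<psi>) p + (- d1 k p / (k p)\<^sup>2) *\<^sub>R d2 \<psi> p + h p *\<^sub>R d1 \<psi> p = 0"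
        unfolding dder_d_psi[OF p] d_psi[OF p] d1_d2_k[OF p] h_def using k_nonzero[OF p]
        by (simp add: vec_eq_iff field_simps power2_eq_square)
      finally have "d1 (d2 X) p = d1 h p *\<^sub>R (\<iota> (\<psi> p) + e)" using linear_0[OF lin] by simp
      also have "\<dots> = (d1 h p * k p) *\<^sub>R X p" unfolding X_def using k_nonzero[OF p] by simp
      finally show ?thesis by (simp add: span_scale span_base)
    qed
    define P where "P = \<iota> (\<psi> p) + e"
    have Phi: "\<iota> (\<phi> p) + e = P + g p *\<^sub>R \<iota> (Y p) + (k p / \<theta>) *\<^sub>R \<iota> (Z p)"
      unfolding \<phi>_def P_def by (simp add: lin_simps)
    have "d1 X' p = A *\<^sub>R X' p + \<theta> *\<^sub>R (d1 X p + A *\<^sub>R X p)" if A: "A = a p + d1 k p / k p - d1 g p / g p" for A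
      unfolding dX[OF p] dX'[OF p] unfolding X_def X'_def d_phi[OF p] d_psi[OF p] Phi P_def[symmetric]
      using darboux_identity[OF theta g[OF p] k_nonzero[OF p] d_g(1)[OF p] A]
      by (simp add: vec_eq_iff lin_simps)
    then show "\<exists>A. d1 X' p = A *\<^sub>R X' p + \<theta> *\<^sub>R (d1 X p + A *\<^sub>R X p)" by blast
    have "d2 X' p = B *\<^sub>R X' p - \<theta> *\<^sub>R (d2 X p + B *\<^sub>R X p)" if B: "B = b p + d2 k p / k p - d2 g p / g p" for B
      unfolding dX[OF p] dX'[OF p] unfolding X_def X'_def d_phi[OF p] d_psi[OF p] Phi P_def[symmetric]
      using darboux_identity'[OF theta g[OF p] k_nonzero[OF p] d_g(2)[OF p] B]
      by (simp add: vec_eq_iff lin_simps)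
    then show "\<exists>B. d2 X' p = B *\<^sub>R X' p - \<theta> *\<^sub>R (d2 X p + B *\<^sub>R X p)" by blast
  qed
  then show ?thesis unfolding X_def X'_def .
qed

end

section \<open>From coordinate frames to the invariant notions\<close>

lemma span_singleton_eqE:
  fixes x :: "'b::real_vector"
  assumes "span {x} = span {x'}" "x \<noteq> 0"
  obtains t where "t \<noteq> 0" "x' = t *\<^sub>R x"
proof -
  have "x' \<in> span {x}" "x \<in> span {x'}" using assms(1) span_base by blast+
  then obtain t s where "x' = t *\<^sub>R x" "x = s *\<^sub>R x'" unfolding span_singleton by blast
  moreover from this have "t \<noteq> 0" using assms(2) by auto
  ultimately show ?thesis using that by blast
qed

lemma conformal_frame_subset:
  "conformal_frame N W Y \<Longrightarrow> open U \<Longrightarrow> U \<subseteq> W \<Longrightarrow> conformal_frame N U Y"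
  unfolding conformal_frame_def using smooth_on_subset by blast

lemma isothermic_frame_subset:
  "isothermic_frame N W Y \<Longrightarrow> open U \<Longrightarrow> U \<subseteq> W \<Longrightarrow> isothermic_frame N U Y"
  unfolding isothermic_frame_def isothermic_frame_axioms_def using conformal_frame_subset by blast

lemma polar_darboux_subset:
  "polar_darboux N W Y Z \<theta> \<psi> c \<Longrightarrow> open U \<Longrightarrow> U \<subseteq> W \<Longrightarrow> polar_darboux N U Y Z \<theta> \<psi> c"
  unfolding polar_darboux_def polar_darboux_axioms_def darboux_frame_def darboux_frame_axioms_def
    polar_frame_def polar_frame_axioms_def
  using isothermic_frame_subset[of N W Y U] smooth_on_subset[of W _ U] by blast

lemma conformal_frame_unique:
  assumes "conformal_frame N W Y" "conformal_frame N W Y'" "p \<in> W"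
    and span: "\<And>q. q \<in> W \<Longrightarrow> span {Y q} = span {Y' q}"
  obtains U \<epsilon> where "open U" "p \<in> U" "U \<subseteq> W" "\<epsilon> \<noteq> 0" "\<And>q. q \<in> U \<Longrightarrow> Y' q = \<epsilon> *\<^sub>R Y q"
proof -
  interpret A: conformal_frame N W Y by fact
  interpret B: conformal_frame N W Y' by fact
  obtain i where i: "Y p $ i \<noteq> 0" using A.Y_nonzero[OF assms(3)] by (auto simp: vec_eq_iff)
  have s: "smooth_on W (\<lambda>q. Y q $ i)" "smooth_on W (\<lambda>q. Y' q $ i)"
    by (rule smooth_on_bounded_linear[OF A.open_W bounded_linear_vec_nth], fact A.smooth_Y B.smooth_Y)+
  define U0 where "U0 = {q \<in> W. Y q $ i \<noteq> 0}"
  have oU0: "open U0"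
    using continuous_open_preimage[OF smooth_on_continuous[OF s(1)] A.open_W, of "- {0}"]
    by (simp add: U0_def vimage_def Int_def open_Compl)
  define f where "f = (\<lambda>q. Y' q $ i / Y q $ i)"
  have U0: "U0 \<subseteq> W" by (auto simp: U0_def)
  have sf: "smooth_on U0 f" unfolding f_def
    by (intro smooth_on_divide oU0 smooth_on_subset[OF s(1) U0] smooth_on_subset[OF s(2) U0]) (simp add: U0_def)
  have fY: "Y' q = f q *\<^sub>R Y q" if "q \<in> U0" for q
  proof -
    have q: "q \<in> W" "Y q $ i \<noteq> 0" using that by (auto simp: U0_def)
    obtain t where "Y' q = t *\<^sub>R Y q" using span_singleton_eqE[OF span[OF q(1)] A.Y_nonzero[OF q(1)]] by blast
    then show ?thesis using q by (simp add: f_def)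
  qed
  have f1: "f q = 1 \<or> f q = -1" if q: "q \<in> U0" for q
  proof -
    have qW: "q \<in> W" using q U0 by blast
    have "d1 Y' q = d1 (\<lambda>q. f q *\<^sub>R Y q) q" by (rule dder_cong[OF oU0 q fY])
    also have "\<dots> = f q *\<^sub>R d1 Y q + d1 f q *\<^sub>R Y q"
      by (rule dder_scaleR[OF sf smooth_on_subset[OF A.smooth_Y U0] q])
    finally have "1 = f q * f q" using B.Y1_Y1[OF qW]
      by (simp add: sig_inner_simps A.frame_simps[OF qW])
    then show ?thesis by (metis square_eq_1_iff)
  qed
  define U where "U = {q \<in> U0. f q * f p \<in> {0<..}}"
  have p0: "p \<in> U0" using i assms(3) by (simp add: U0_def)
  have "open U" unfolding U_def
    using continuous_open_preimage[OF continuous_on_mult_right[OF smooth_on_continuous[OF sf]] oU0 open_greaterThan, of "f p" 0]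
    by (simp add: vimage_def Int_def)
  moreover have "p \<in> U" using p0 f1[OF p0] by (auto simp: U_def)
  moreover have "f q = f p" if "q \<in> U" for q
    using that f1[OF p0] f1[of q] by (auto simp: U_def)
  then have "Y' q = f p *\<^sub>R Y q" if "q \<in> U" for q
    using fY[of q] that by (simp add: U_def)
  moreover have "f p \<noteq> 0" using f1[OF p0] by auto
  ultimately show ?thesis using that U0 by (metis (no_types, lifting) U_def mem_Collect_eq subset_iff)
qed

lemma conformal_frame_transfer:
  assumes "conformal_frame N W Y" "conformal_frame N W' Y'" "p \<in> W" "p \<in> W'"
    and span: "\<And>q. q \<in> W \<inter> W' \<Longrightarrow> span {Y q} = span {Y' q}"
  shows "span {Y p} = span {Y' p}" "d1 (d2 Y) p \<in> span {Y p} \<longleftrightarrow> d1 (d2 Y') p \<in> span {Y' p}"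
    "V_space Y p = V_space Y' p"
proof -
  have o: "open (W \<inter> W')" using assms(1,2) by (auto simp: conformal_frame_def)
  have c: "conformal_frame N (W \<inter> W') Y" "conformal_frame N (W \<inter> W') Y'"
    using conformal_frame_subset[OF assms(1) o] conformal_frame_subset[OF assms(2) o] by auto
  obtain U \<epsilon> where U: "open U" "p \<in> U" "U \<subseteq> W \<inter> W'" "\<epsilon> \<noteq> 0" "\<And>q. q \<in> U \<Longrightarrow> Y' q = \<epsilon> *\<^sub>R Y q"
    using conformal_frame_unique[OF c _ span, of p] assms(3,4) by auto
  interpret A: conformal_frame N U Y by (rule conformal_frame_subset[OF c(1) U(1,3)])
  interpret B: conformal_frame N U Y' by (rule conformal_frame_subset[OF c(2) U(1,3)])
  have d: "dder v Y' q = \<epsilon> *\<^sub>R dder v Y q" if "q \<in> U" for v q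
    using dder_cong[OF U(1) that U(5), where v=v] dder_scaleR_const[OF smooth_on_differentiable[OF A.smooth_Y that], of v \<epsilon>] by simp
  have dd: "dder w (dder v Y') q = \<epsilon> *\<^sub>R dder w (dder v Y) q" if "q \<in> U" for v w q
    using dder_cong[OF U(1) that d, where v=w] dder_scaleR_const[OF smooth_on_differentiable[OF smooth_on_dder[OF A.smooth_Y] that], of w \<epsilon>] by simp
  have sp: "span ((\<lambda>x. \<epsilon> *\<^sub>R x) ` S) = span S" if "finite S" for S :: "(real ^ 'a) set"
    using real_vector.span_image_scale[OF that, of "\<lambda>_. \<epsilon>"] U(4) by auto
  show "span {Y p} = span {Y' p}" using span U by blast
  have "\<epsilon> *\<^sub>R x \<in> span {\<epsilon> *\<^sub>R Y p} \<longleftrightarrow> x \<in> span {Y p}" for x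
    using sp[of "{Y p}"] span_scale[of x "{Y p}" \<epsilon>] span_scale[of "\<epsilon> *\<^sub>R x" "{Y p}" "1/\<epsilon>"] U(4) by auto
  then show "d1 (d2 Y) p \<in> span {Y p} \<longleftrightarrow> d1 (d2 Y') p \<in> span {Y' p}"
    unfolding dd[OF U(2)] U(5)[OF U(2)] by blast
  have V: "V_space Y' p = span ((\<lambda>x. \<epsilon> *\<^sub>R x) ` {Y p, d1 Y p, d2 Y p, d1 (d1 Y) p + d2 (d2 Y) p})"
    unfolding B.V_space_eq[OF U(2)] by (simp add: U(5)[OF U(2)] d[OF U(2)] dd[OF U(2)] scaleR_right_distrib)
  show "V_space Y p = V_space Y' p" unfolding V A.V_space_eq[OF U(2)] by (rule sp[symmetric]) simp
qed

lemma canonical_lift_onD: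
  assumes "canonical_lift_on N W y Y" "open W"
  shows "conformal_frame N W Y" "q \<in> W \<Longrightarrow> y q = span {Y q}"
  using assms canonical_lift_on_iff[OF assms(2), of N y Y] by blast+

lemma isothermic_onD:
  assumes "isothermic_on N D y" "conformal_frame N W Y" "W \<subseteq> D" "\<And>q. q \<in> W \<Longrightarrow> y q = span {Y q}"
  shows "isothermic_frame N W Y"
proof -
  have "d1 (d2 Y) p \<in> span {Y p}" if p: "p \<in> W" for p
  proof -
    obtain W' Y' where W': "open W'" "p \<in> W'" "canonical_lift_on N W' y Y'"
      "\<forall>q\<in>W'. hopf_differential N Y' q \<in> range cvec"
      using assms(1,3) p unfolding isothermic_on_def by (meson subsetD)
    note c = canonical_lift_onD[OF \<open>canonical_lift_on N W' y Y'\<close> W'(1)]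
    have "d1 (d2 Y') p \<in> span {Y' p}" using conformal_frame.hopf_real_iff[OF c(1) W'(2)] W'(2,4) by blast
    then show ?thesis
      using conformal_frame_transfer(2)[OF assms(2) c(1) p W'(2)] assms(4) c(2) by (metis IntD1 IntD2)
  qed
  then show ?thesis using assms(2) by (simp add: isothermic_frame_def isothermic_frame_axioms_def)
qed

lemma c_polar_onD:
  assumes "c_polar_on N D c y \<psi>" "conformal_frame N W Y" "W \<subseteq> D" "\<And>q. q \<in> W \<Longrightarrow> y q = span {Y q}"
  shows "polar_frame N W Y \<psi> c"
proof -
  interpret isothermic_frame N W Y
    using isothermic_onD[OF _ assms(2-4)] assms(1) unfolding c_polar_on_def by blast
  have sm: "smooth_on D \<psi>" using assms(1) unfolding c_polar_on_def by blast
  have psi: "\<psi> p \<in> V_perp N Y p \<and> d1 \<psi> p \<in> V_space Y p \<and> d2 \<psi> p \<in> V_space Y p" if p: "p \<in> W" for p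
  proof -
    have "\<forall>p\<in>D. \<exists>W Y. open W \<and> p \<in> W \<and> W \<subseteq> D \<and> canonical_lift_on N W y Y \<and>
        (\<forall>q\<in>W. \<psi> q \<in> V_perp N Y q \<and> normal_D_z N Y \<psi> q = 0)"
      using assms(1) unfolding c_polar_on_def by blast
    then obtain W' Y' where W': "open W'" "p \<in> W'" "W' \<subseteq> D" "canonical_lift_on N W' y Y'"
      "\<forall>q\<in>W'. \<psi> q \<in> V_perp N Y' q \<and> normal_D_z N Y' \<psi> q = 0"
      using assms(3) p by (meson subsetD)
    note c = canonical_lift_onD[OF \<open>canonical_lift_on N W' y Y'\<close> W'(1)]
    have "V_space Y p = V_space Y' p"
      using conformal_frame_transfer(3)[OF assms(2) c(1) p W'(2)] assms(4) c(2) by (metis IntD1 IntD2)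
    moreover have "\<psi> differentiable (at p)" using smooth_on_differentiable[OF sm] assms(3) p by blast
    ultimately show ?thesis
      using W' conformal_frame.normal_D_z_eq_0_iff[OF c(1) W'(2)] unfolding V_perp_def by auto
  qed
  show ?thesis
  proof
    show "smooth_on W \<psi>" by (rule smooth_on_subset[OF sm assms(3)])
    show "sig_inner N (\<psi> p) (\<psi> p) = c" if "p \<in> W" for p
      using assms(1,3) that unfolding c_polar_on_def by blast
  qed (use psi in auto)
qed

lemma darboux_equation_iff:
  fixes Y Z :: "complex \<Rightarrow> real ^ 'm::finite"
  assumes "Y differentiable (at p)" "Z differentiable (at p)"
  shows "d_z (cfun Z) p = (\<mu> / 2) *s cvec (Z p) + complex_of_real \<theta> *s (d_zbar (cfun Y) p + (cnj \<mu> / 2) *s cvec (Y p))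
    \<longleftrightarrow> d1 Z p = Re \<mu> *\<^sub>R Z p + \<theta> *\<^sub>R (d1 Y p + Re \<mu> *\<^sub>R Y p) \<and>
        d2 Z p = (- Im \<mu>) *\<^sub>R Z p - \<theta> *\<^sub>R (d2 Y p + (- Im \<mu>) *\<^sub>R Y p)" (is "?L = ?R \<longleftrightarrow> ?A \<and> ?B")
proof -
  have "?L = ?R \<longleftrightarrow> Re_vec ?L = Re_vec ?R \<and> Im_vec ?L = Im_vec ?R"
    by (rule iffI[OF conjI[OF arg_cong arg_cong] Re_Im_vec_eqI]; blast)
  also have "Re_vec ?L = Re_vec ?R \<longleftrightarrow> (1/2) *\<^sub>R d1 Z p = (1/2) *\<^sub>R (Re \<mu> *\<^sub>R Z p + \<theta> *\<^sub>R (d1 Y p + Re \<mu> *\<^sub>R Y p))"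
    by (simp add: Re_Im_d_z_cfun[OF assms(1)] Re_Im_d_z_cfun[OF assms(2)] scaleR_right_distrib)
  also have "\<dots> \<longleftrightarrow> ?A" by (simp only: scaleR_cancel_left) simp
  also have "Im_vec ?L = Im_vec ?R \<longleftrightarrow> (-1/2) *\<^sub>R d2 Z p = (-1/2) *\<^sub>R ((- Im \<mu>) *\<^sub>R Z p - \<theta> *\<^sub>R (d2 Y p + (- Im \<mu>) *\<^sub>R Y p))"
    by (simp add: Re_Im_d_z_cfun[OF assms(1)] Re_Im_d_z_cfun[OF assms(2)] scaleR_right_distrib scaleR_right_diff_distrib algebra_simps)
  also have "\<dots> \<longleftrightarrow> ?B" by (simp only: scaleR_cancel_left) simp
  finally show ?thesis .
qed

lemma polar_darboux_ex:
  assumes "D_transform_on N D \<theta> y ys" "c_polar_on N D c y \<psi>" "nondegenerate_on N D \<psi>" "p \<in> D"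
  obtains W Y Z where "p \<in> W" "W \<subseteq> D" "polar_darboux N W Y Z \<theta> \<psi> c"
    "\<And>q. q \<in> W \<Longrightarrow> y q = span {Y q} \<and> ys q = span {Z q}"
proof -
  have theta: "\<theta> \<noteq> 0"
    using assms(1) unfolding D_transform_on_def by blast
  have "\<exists>W Y Ys \<mu>. open W \<and> p \<in> W \<and> W \<subseteq> D \<and> canonical_lift_on N W y Y \<and> lift_on N W ys Ys \<and>
        (\<forall>q\<in>W. sig_inner N (Y q) (Ys q) = - 1 \<and>
           d_z (cfun Ys) q = (\<mu> q / 2) *s cvec (Ys q) +
             complex_of_real \<theta> *s (d_zbar (cfun Y) q + (cnj (\<mu> q) / 2) *s cvec (Y q)))"
    using assms(1,4) unfolding D_transform_on_def by blast
  then obtain W Y Z \<mu> where W: "open W" "p \<in> W" "W \<subseteq> D" "canonical_lift_on N W y Y" "lift_on N W ys Z"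
    and eqs: "\<forall>q\<in>W. sig_inner N (Y q) (Z q) = - 1 \<and> d_z (cfun Z) q = (\<mu> q / 2) *s cvec (Z q) +
             complex_of_real \<theta> *s (d_zbar (cfun Y) q + (cnj (\<mu> q) / 2) *s cvec (Y q))"
    by (elim exE conjE)
  note c = canonical_lift_onD[OF W(4) W(1)]
  have Z: "smooth_on W Z" "\<And>q. q \<in> W \<Longrightarrow> sig_inner N (Z q) (Z q) = 0" "\<And>q. q \<in> W \<Longrightarrow> ys q = span {Z q}"
    using W(5) unfolding lift_on_def light_cone_def by auto
  interpret polar_frame N W Y \<psi> c by (rule c_polar_onD[OF assms(2) c(1) W(3) c(2)])
  have eq: "d1 Z q = Re (\<mu> q) *\<^sub>R Z q + \<theta> *\<^sub>R (d1 Y q + Re (\<mu> q) *\<^sub>R Y q)"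
    "d2 Z q = (- Im (\<mu> q)) *\<^sub>R Z q - \<theta> *\<^sub>R (d2 Y q + (- Im (\<mu> q)) *\<^sub>R Y q)" if "q \<in> W" for q
    using eqs that darboux_equation_iff[OF smooth_on_differentiable[OF smooth_Y that] smooth_on_differentiable[OF Z(1) that]]
    by auto
  have "polar_darboux N W Y Z \<theta> \<psi> c"
  proof
    show "smooth_on W Z" "\<theta> \<noteq> 0" using Z theta by auto
    fix q assume q: "q \<in> W"
    show "sig_inner N (Z q) (Z q) = 0" "sig_inner N (Y q) (Z q) = - 1" using Z eqs q by auto
    show "\<exists>a. d1 Z q = a *\<^sub>R Z q + \<theta> *\<^sub>R (d1 Y q + a *\<^sub>R Y q)" using eq(1)[OF q] by blast
    show "\<exists>b. d2 Z q = b *\<^sub>R Z q - \<theta> *\<^sub>R (d2 Y q + b *\<^sub>R Y q)" using eq(2)[OF q] by blast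
    have "induced_metric N \<psi> q 1 > 0"
      using assms(3) q W(3) unfolding nondegenerate_on_def by (metis one_neq_zero subsetD)
    then have "sig_inner N (d1 \<psi> q) (d1 \<psi> q) > 0" unfolding induced_metric_def dder_def .
    then show "k q \<noteq> 0" unfolding d_psi[OF q] by (auto simp: sig_inner_simps frame_simps[OF q])
  qed
  then show ?thesis using that[OF W(2,3)] c(2) Z(3) by simp
qed

lemma isothermic_onI:
  assumes "\<And>p. p \<in> D \<Longrightarrow> \<exists>W Y. p \<in> W \<and> W \<subseteq> D \<and> isothermic_frame N W Y \<and> (\<forall>q\<in>W. y q = span {Y q})"
  shows "isothermic_on N D y"
proof -
  have loc: "\<exists>W Y. open W \<and> p \<in> W \<and> W \<subseteq> D \<and> canonical_lift_on N W y Y \<and> (\<forall>q\<in>W. hopf_differential N Y q \<in> range cvec)"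
    if p: "p \<in> D" for p
  proof -
    obtain W Y where W: "p \<in> W" "W \<subseteq> D" "isothermic_frame N W Y" "\<forall>q\<in>W. y q = span {Y q}" using assms[OF p] by blast
    interpret isothermic_frame N W Y by fact
    have "canonical_lift_on N W y Y" unfolding canonical_lift_on_iff[OF open_W] using conformal_frame_axioms W(4) by simp
    moreover have "\<forall>q\<in>W. hopf_differential N Y q \<in> range cvec" using hopf_real_iff mixed by blast
    ultimately show ?thesis using open_W W by blast
  qed
  have "y p \<in> null_quadric N" if p: "p \<in> D" for p
    using loc[OF p] unfolding canonical_lift_on_def lift_on_def null_quadric_def by blast
  moreover have "\<exists>W L. open W \<and> p \<in> W \<and> W \<subseteq> D \<and> lift_on N W y L \<and>
        (\<forall>q\<in>W. \<exists>\<rho>>0. \<forall>v. induced_metric N L q v = \<rho> * (norm v)\<^sup>2)" if p: "p \<in> D" for p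
    using loc[OF p] unfolding canonical_lift_on_def by (metis mult_1 zero_less_one)
  ultimately have "spacelike_on N D y" unfolding spacelike_on_def by (simp add: image_subset_iff)
  then show ?thesis unfolding isothermic_on_def using loc by simp
qed

lemma c_polar_onI:
  assumes "\<And>p. p \<in> D \<Longrightarrow> \<exists>W Y. p \<in> W \<and> W \<subseteq> D \<and> polar_frame N W Y \<psi> c \<and> \<psi> p \<noteq> 0 \<and> (\<forall>q\<in>W. y q = span {Y q})"
  shows "c_polar_on N D c y \<psi>"
  unfolding c_polar_on_def
proof (intro conjI ballI)
  show "isothermic_on N D y"
  proof (rule isothermic_onI)
    fix p assume "p \<in> D"
    from assms[OF this] obtain W Y where W: "p \<in> W" "W \<subseteq> D" "polar_frame N W Y \<psi> c"
      "\<forall>q\<in>W. y q = span {Y q}" by (elim exE conjE)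
    show "\<exists>W Y. p \<in> W \<and> W \<subseteq> D \<and> isothermic_frame N W Y \<and> (\<forall>q\<in>W. y q = span {Y q})"
      by (intro exI conjI, rule W(1), rule W(2), rule polar_frame.axioms(1)[OF W(3)], rule W(4))
  qed
  show "smooth_on D \<psi>"
  proof (rule smooth_on_local)
    fix p assume "p \<in> D"
    from assms[OF this] obtain W Y where W: "p \<in> W" "polar_frame N W Y \<psi> c" by (elim exE conjE)
    interpret polar_frame N W Y \<psi> c by fact
    show "\<exists>W. open W \<and> p \<in> W \<and> smooth_on W \<psi>" using W open_W smooth_psi by blast
  qed
  fix p assume "p \<in> D"
  from assms[OF this] obtain W Y where W: "p \<in> W" "W \<subseteq> D" "polar_frame N W Y \<psi> c" "\<psi> p \<noteq> 0"
    "\<forall>q\<in>W. y q = span {Y q}" by (elim exE conjE)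
  interpret polar_frame N W Y \<psi> c by fact
  show "\<psi> p \<noteq> 0" "sig_inner N (\<psi> p) (\<psi> p) = c" using W psi_psi by auto
  have can: "canonical_lift_on N W y Y" unfolding canonical_lift_on_iff[OF open_W] using conformal_frame_axioms W(5) by simp
  have "normal_D_z N Y \<psi> q = 0" if "q \<in> W" for q
    using normal_D_z_eq_0_iff[OF that smooth_on_differentiable[OF smooth_psi that]] d_psi_V that by blast
  then have V: "\<forall>q\<in>W. \<psi> q \<in> V_perp N Y q \<and> normal_D_z N Y \<psi> q = 0"
    using psi_perp by simp
  show "\<exists>W Y. open W \<and> p \<in> W \<and> W \<subseteq> D \<and> canonical_lift_on N W y Y \<and>
      (\<forall>q\<in>W. \<psi> q \<in> V_perp N Y q \<and> normal_D_z N Y \<psi> q = 0)"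
    by (intro exI conjI, (rule open_W W(1) W(2) can V)+)
qed

lemma D_transform_onI:
  assumes "\<theta> \<noteq> 0" "\<And>p. p \<in> D \<Longrightarrow> \<exists>W Y Z. p \<in> W \<and> W \<subseteq> D \<and> darboux_frame N W Y Z \<theta> \<and> (\<forall>q\<in>W. y q = span {Y q} \<and> ys q = span {Z q})"
  shows "D_transform_on N D \<theta> y ys"
proof -
  have iso: "isothermic_on N D y"
  proof (rule isothermic_onI)
    fix p assume "p \<in> D"
    from assms(2)[OF this] obtain W Y Z where W: "p \<in> W" "W \<subseteq> D" "darboux_frame N W Y Z \<theta>"
      "\<forall>q\<in>W. y q = span {Y q} \<and> ys q = span {Z q}" by (elim exE conjE)
    show "\<exists>W Y. p \<in> W \<and> W \<subseteq> D \<and> isothermic_frame N W Y \<and> (\<forall>q\<in>W. y q = span {Y q})"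
      by (intro exI conjI, rule W(1), rule W(2), rule darboux_frame.axioms(1)[OF W(3)]) (use W(4) in blast)
  qed
  have "isothermic_on N D ys"
  proof (rule isothermic_onI)
    fix p assume "p \<in> D"
    from assms(2)[OF this] obtain W Y Z where W: "p \<in> W" "W \<subseteq> D" "darboux_frame N W Y Z \<theta>"
      "\<forall>q\<in>W. y q = span {Y q} \<and> ys q = span {Z q}" by (elim exE conjE)
    have "span {Z q} = span {(1 / \<bar>\<theta>\<bar>) *\<^sub>R Z q}" for q
      using real_vector.span_image_scale[of "{Z q}" "\<lambda>_. 1 / \<bar>\<theta>\<bar>"] assms(1) by simp
    then have V: "\<forall>q\<in>W. ys q = span {(1 / \<bar>\<theta>\<bar>) *\<^sub>R Z q}" using W(4) by simp
    show "\<exists>W Y. p \<in> W \<and> W \<subseteq> D \<and> isothermic_frame N W Y \<and> (\<forall>q\<in>W. ys q = span {Y q})"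
      by (intro exI conjI, (rule W(1) W(2) darboux_frame.isothermic_frame_Z[OF W(3)] V)+)
  qed
  then have sp: "spacelike_on N D ys" unfolding isothermic_on_def by blast
  have loc: "\<exists>W Y Ys \<mu>. open W \<and> p \<in> W \<and> W \<subseteq> D \<and> canonical_lift_on N W y Y \<and> lift_on N W ys Ys \<and>
        (\<forall>q\<in>W. sig_inner N (Y q) (Ys q) = - 1 \<and>
           d_z (cfun Ys) q = (\<mu> q / 2) *s cvec (Ys q) +
             complex_of_real \<theta> *s (d_zbar (cfun Y) q + (cnj (\<mu> q) / 2) *s cvec (Y q)))" if "p \<in> D" for p
  proof -
    from assms(2)[OF that] obtain W Y Z where W: "p \<in> W" "W \<subseteq> D" "darboux_frame N W Y Z \<theta>"
      "\<forall>q\<in>W. y q = span {Y q} \<and> ys q = span {Z q}" by (elim exE conjE)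
    interpret darboux_frame N W Y Z \<theta> by fact
    have c: "canonical_lift_on N W y Y" unfolding canonical_lift_on_iff[OF open_W] using conformal_frame_axioms W(4) by simp
    have "Z q \<noteq> 0" if "q \<in> W" for q using Y_Z[OF that] by (auto simp: sig_inner_simps)
    then have l: "lift_on N W ys Z" unfolding lift_on_def light_cone_def using smooth_Z Z_Z W(4) by auto
    have "sig_inner N (Y q) (Z q) = - 1 \<and> d_z (cfun Z) q = (Complex (a q) (- b q) / 2) *s cvec (Z q) +
             complex_of_real \<theta> *s (d_zbar (cfun Y) q + (cnj (Complex (a q) (- b q)) / 2) *s cvec (Y q))" if "q \<in> W" for q
      unfolding darboux_equation_iff[OF smooth_on_differentiable[OF smooth_Y that] smooth_on_differentiable[OF smooth_Z that]]
      using Z1[OF that] Z2[OF that] Y_Z[OF that] by simp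
    then have V: "\<forall>q\<in>W. sig_inner N (Y q) (Z q) = - 1 \<and> d_z (cfun Z) q = (m q / 2) *s cvec (Z q) +
             complex_of_real \<theta> *s (d_zbar (cfun Y) q + (cnj (m q) / 2) *s cvec (Y q))"
      if "m = (\<lambda>q. Complex (a q) (- b q))" for m
      unfolding that by simp
    show ?thesis by (intro exI conjI, (rule open_W W(1) W(2) c l V[OF refl])+)
  qed
  have "darboux_transform_on N D y ys" unfolding darboux_transform_on_def
  proof (intro conjI ballI iso sp)
    fix p assume "p \<in> D"
    from loc[OF this] obtain W Y Ys \<mu> where W: "open W" "p \<in> W" "W \<subseteq> D" "canonical_lift_on N W y Y" "lift_on N W ys Ys"
      and eqs: "\<forall>q\<in>W. sig_inner N (Y q) (Ys q) = - 1 \<and> d_z (cfun Ys) q = (\<mu> q / 2) *s cvec (Ys q) +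
             complex_of_real \<theta> *s (d_zbar (cfun Y) q + (cnj (\<mu> q) / 2) *s cvec (Y q))"
      by (elim exE conjE)
    have "d_z (cfun Ys) q \<in> vec.span {cvec (Ys q), cvec (Y q), d_zbar (cfun Y) q}" if "q \<in> W" for q
      unfolding bspec[OF eqs that, THEN conjunct2] by (intro vec.span_add vec.span_scale vec.span_base) auto
    then have V: "\<forall>q\<in>W. sig_inner N (Y q) (Ys q) \<noteq> 0 \<and>
           d_z (cfun Ys) q \<in> vec.span {cvec (Ys q), cvec (Y q), d_zbar (cfun Y) q}" using eqs by simp
    show "\<exists>W Y Ys. open W \<and> p \<in> W \<and> W \<subseteq> D \<and> canonical_lift_on N W y Y \<and> lift_on N W ys Ys \<and>
        (\<forall>q\<in>W. sig_inner N (Y q) (Ys q) \<noteq> 0 \<and>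
           d_z (cfun Ys) q \<in> vec.span {cvec (Ys q), cvec (Y q), d_zbar (cfun Y) q})"
      by (intro exI conjI, (rule W V)+)
  qed
  then show ?thesis unfolding D_transform_on_def using assms(1) loc by blast
qed

section \<open>Gluing over the atlas\<close>

text \<open>
  The value of the transformed polar surface is pinned down by the first derivatives of
  \<open>\<psi>\<close> and of a lift \<open>Z\<close> of \<open>ys\<close>. The condition involves no complex structure, so it does not
  depend on the coordinate, and the values found in different charts agree.
\<close>

definition polar_value ::
  "'m::finite set \<Rightarrow> (complex \<Rightarrow> (real ^ 'm) set) \<Rightarrow> (complex \<Rightarrow> (real ^ 'm) set) \<Rightarrow> (complex \<Rightarrow> real ^ 'm) \<Rightarrow>
    complex \<Rightarrow> real ^ 'm \<Rightarrow> bool" where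
  "polar_value N y ys \<psi> p x \<longleftrightarrow>
     (\<exists>W Z y0 \<alpha>. open W \<and> p \<in> W \<and> smooth_on W Z \<and> (\<forall>q\<in>W. Z q \<noteq> 0 \<and> ys q = span {Z q}) \<and>
        y p = span {y0} \<and> sig_inner N y0 (Z p) = -1 \<and> \<psi> differentiable (at p) \<and>
        x = \<psi> p + sig_inner N (\<psi> p) (Z p) *\<^sub>R y0 + \<alpha> *\<^sub>R Z p \<and>
        (\<forall>v. dder v \<psi> p + \<alpha> *\<^sub>R dder v Z p \<in> span {y0, Z p}) \<and>
        (\<exists>v. dder v Z p \<notin> span {y0, Z p}))"

lemma span_scale_pair:
  fixes x y :: "'b::real_vector"
  assumes "t \<noteq> 0" "s \<noteq> 0"
  shows "span {t *\<^sub>R x, s *\<^sub>R y} = span {x, y}"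
proof (rule span_eq[THEN iffD2], intro conjI)
  show "{t *\<^sub>R x, s *\<^sub>R y} \<subseteq> span {x, y}" by (auto intro: span_scale span_base)
  have "(1/t) *\<^sub>R t *\<^sub>R x \<in> span {t *\<^sub>R x, s *\<^sub>R y}" "(1/s) *\<^sub>R s *\<^sub>R y \<in> span {t *\<^sub>R x, s *\<^sub>R y}"
    by (intro span_scale span_base; simp)+
  then show "{x, y} \<subseteq> span {t *\<^sub>R x, s *\<^sub>R y}" using assms by simp
qed

lemma dder_compose:
  assumes "f differentiable (at (T p))" "(T has_derivative T') (at p)"
    "open W" "p \<in> W" "\<And>q. q \<in> W \<Longrightarrow> h q = f (T q)"
  shows "dder v h p = dder (T' v) f (T p)"
proof -
  have "dder v h p = dder v (f \<circ> T) p" by (rule dder_cong[OF assms(3,4)]) (simp add: assms(5))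
  also have "\<dots> = dder (T' v) f (T p)"
    using dder_eq[OF diff_chain_at[OF assms(2) has_derivative_dder[OF assms(1)]]] by (simp add: o_def)
  finally show ?thesis .
qed

lemma polar_value_unique:
  assumes val': "polar_value N y' ys' \<psi>' p x'" and val: "polar_value N y ys \<psi> (T p) x"
    and V: "open V" "p \<in> V" and T: "continuous_on V T" "T differentiable (at p)"
    and eq: "\<And>q. q \<in> V \<Longrightarrow> y' q = y (T q) \<and> ys' q = ys (T q) \<and> \<psi>' q = \<psi> (T q)"
  shows "x' = x"
proof -
  from val' obtain W' Z' y0' \<alpha>' v where W': "open W'" "p \<in> W'" "smooth_on W' Z'"
    and Z': "\<forall>q\<in>W'. Z' q \<noteq> 0 \<and> ys' q = span {Z' q}"
    and y0': "y' p = span {y0'}" "sig_inner N y0' (Z' p) = -1"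
    and x': "x' = \<psi>' p + sig_inner N (\<psi>' p) (Z' p) *\<^sub>R y0' + \<alpha>' *\<^sub>R Z' p"
    and d': "\<forall>v. dder v \<psi>' p + \<alpha>' *\<^sub>R dder v Z' p \<in> span {y0', Z' p}"
    and ex': "dder v Z' p \<notin> span {y0', Z' p}"
    unfolding polar_value_def by (elim exE conjE)
  from val obtain W Z y0 \<alpha> where W: "open W" "T p \<in> W" "smooth_on W Z"
    and Z: "\<forall>q\<in>W. Z q \<noteq> 0 \<and> ys q = span {Z q}"
    and y0: "y (T p) = span {y0}" "sig_inner N y0 (Z (T p)) = -1"
    and psi: "\<psi> differentiable (at (T p))"
    and x: "x = \<psi> (T p) + sig_inner N (\<psi> (T p)) (Z (T p)) *\<^sub>R y0 + \<alpha> *\<^sub>R Z (T p)"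
    and d: "\<forall>v. dder v \<psi> (T p) + \<alpha> *\<^sub>R dder v Z (T p) \<in> span {y0, Z (T p)}"
    unfolding polar_value_def by (elim exE conjE)
  define L where "L = (\<lambda>q. Z (T q))"
  define U where "U = (V \<inter> T -` W) \<inter> W'"
  have U: "open U" "p \<in> U" "U \<subseteq> V" "U \<subseteq> W'"
    using open_Int[OF continuous_open_preimage[OF T(1) V(1) W(1)] W'(1)] V W W'
    by (auto simp: U_def)
  obtain T' where T': "(T has_derivative T') (at p)" using T(2) differentiable_def by blast
  have dL: "dder v L p = dder (T' v) Z (T p)" for v
    by (rule dder_compose[OF smooth_on_differentiable[OF W(3,2)] T' U(1,2)]) (simp add: L_def)
  have dpsi: "dder v \<psi>' p = dder (T' v) \<psi> (T p)" for v
    by (rule dder_compose[OF psi T' V]) (simp add: eq)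
  have Lp: "L p \<noteq> 0" using Z W(2) by (simp add: L_def)
  have same: "span {L q} = span {Z' q}" if "q \<in> U" for q
    using that Z Z' eq[of q] by (auto simp: U_def L_def)
  have multiple: "\<exists>t. Z' q = t *\<^sub>R L q" if "q \<in> U" for q
  proof -
    have "L q \<noteq> 0" using Z that by (simp add: L_def U_def)
    from span_singleton_eqE[OF same[OF that] this] show ?thesis by blast
  qed
  obtain f where f: "f \<noteq> 0" "Z' p = f *\<^sub>R L p" using span_singleton_eqE[OF same[OF U(2)] Lp] by blast
  obtain t where t: "t \<noteq> 0" "y0' = t *\<^sub>R y0"
    using span_singleton_eqE[of y0 y0'] y0 y0' eq[OF V(2)] by (metis bounded_bilinear.zero_left[OF bounded_bilinear_sig_inner] zero_neq_neg_one)
  have tf: "t * f = 1" using y0'(2) y0(2) unfolding t f by (simp add: sig_inner_simps L_def mult.commute)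
  obtain i where i: "L p $ i \<noteq> 0" using Lp by (auto simp: vec_eq_iff)
  have comp: "bounded_linear (\<lambda>x. x $ i)" by (rule bounded_linear_vec_nth)
  have LhD: "(L has_derivative (\<lambda>v. dder v L p)) (at p)"
    using diff_chain_at[OF T' has_derivative_dder[OF smooth_on_differentiable[OF W(3,2)]]]
    by (auto intro!: has_derivative_dder simp: differentiable_def L_def o_def)
  have ZhD: "(Z' has_derivative (\<lambda>v. dder v Z' p)) (at p)"
    by (rule smooth_on_has_derivative[OF W'(3,2)])
  have dZ: "\<exists>s. dder v Z' p = f *\<^sub>R dder v L p + s *\<^sub>R L p" for v
  proof -
    have 1: "dder v (\<lambda>q. Z' q $ i *\<^sub>R L q) p = Z' p $ i *\<^sub>R dder v L p + dder v Z' p $ i *\<^sub>R L p"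
      by (rule dder_eq[OF bounded_bilinear.FDERIV[OF bounded_bilinear_scaleR bounded_linear.has_derivative[OF comp ZhD] LhD]])
    have 2: "dder v (\<lambda>q. L q $ i *\<^sub>R Z' q) p = L p $ i *\<^sub>R dder v Z' p + dder v L p $ i *\<^sub>R Z' p"
      by (rule dder_eq[OF bounded_bilinear.FDERIV[OF bounded_bilinear_scaleR bounded_linear.has_derivative[OF comp LhD] ZhD]])
    have "dder v (\<lambda>q. Z' q $ i *\<^sub>R L q) p = dder v (\<lambda>q. L q $ i *\<^sub>R Z' q) p"
    proof (rule dder_cong[OF U(1,2)])
      fix q assume "q \<in> U"
      then obtain t where "Z' q = t *\<^sub>R L q" using multiple by blast
      then show "Z' q $ i *\<^sub>R L q = L q $ i *\<^sub>R Z' q" by simp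
    qed
    then have "L p $ i *\<^sub>R dder v Z' p = L p $ i *\<^sub>R (f *\<^sub>R dder v L p) + (dder v Z' p $ i - dder v L p $ i * f) *\<^sub>R L p"
      unfolding 1 2 f(2) by (simp add: vec_eq_iff algebra_simps)
    also have "\<dots> = L p $ i *\<^sub>R (f *\<^sub>R dder v L p + ((dder v Z' p $ i - dder v L p $ i * f) / L p $ i) *\<^sub>R L p)"
      using i by (simp add: scaleR_right_distrib)
    finally show ?thesis using i by (metis scaleR_cancel_left)
  qed
  define S where "S = span {y0, L p}"
  have S: "subspace S" "L p \<in> S" unfolding S_def by (auto intro: span_base)
  have SS: "span {y0', Z' p} = S"
    unfolding t f S_def by (rule span_scale_pair[OF t(1) f(1)])
  have v: "dder v Z' p \<notin> S" using ex' SS by simp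
  obtain s where s: "dder v Z' p = f *\<^sub>R dder v L p + s *\<^sub>R L p" using dZ by blast
  have nL: "dder v L p \<notin> S" using v unfolding s using S subspace_add subspace_scale by metis
  have A: "dder v \<psi>' p + \<alpha> *\<^sub>R dder v L p \<in> S"
    unfolding dpsi dL S_def using d by (simp add: L_def)
  have B: "dder v \<psi>' p + \<alpha>' *\<^sub>R (f *\<^sub>R dder v L p + s *\<^sub>R L p) \<in> S"
    using d' SS s by metis
  have "(dder v \<psi>' p + \<alpha> *\<^sub>R dder v L p) - (dder v \<psi>' p + \<alpha>' *\<^sub>R (f *\<^sub>R dder v L p + s *\<^sub>R L p)) + (\<alpha>' * s) *\<^sub>R L p \<in> S"
    by (intro subspace_add subspace_diff subspace_scale S A B)
  then have C: "(\<alpha> - \<alpha>' * f) *\<^sub>R dder v L p \<in> S" by (simp add: algebra_simps)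
  have \<alpha>: "\<alpha> = \<alpha>' * f"
  proof (rule ccontr)
    assume "\<alpha> \<noteq> \<alpha>' * f"
    then show False using subspace_scale[OF S(1) C, of "1 / (\<alpha> - \<alpha>' * f)"] nL by simp
  qed
  have "x' = \<psi>' p + (t * f) *\<^sub>R (sig_inner N (\<psi>' p) (L p) *\<^sub>R y0) + (\<alpha>' * f) *\<^sub>R L p"
    unfolding x' t(2) f(2) by (simp add: sig_inner_simps mult.commute mult.left_commute)
  then show "x' = x" unfolding x \<alpha> tf using eq[OF V(2)] by (simp add: L_def)
qed

lemma (in polar_darboux) polar_value_phi:
  assumes p: "p \<in> W" and lifts: "\<And>q. q \<in> W \<Longrightarrow> y q = span {Y q} \<and> ys q = span {Z q}"
  shows "polar_value N y ys \<psi> p (\<phi> p)"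
  unfolding polar_value_def
proof (intro exI conjI)
  show "open W" "p \<in> W" "smooth_on W Z" by (fact open_W p smooth_Z)+
  show "\<forall>q\<in>W. Z q \<noteq> 0 \<and> ys q = span {Z q}"
    using lifts Y_Z by (force simp: sig_inner_simps)
  show "y p = span {Y p}" using lifts p by simp
  show "Y p \<odot> Z p = -1" by (rule Y_Z[OF p])
  show "\<psi> differentiable (at p)" by (rule smooth_on_differentiable[OF smooth_psi p])
  show "\<phi> p = \<psi> p + (\<psi> p \<odot> Z p) *\<^sub>R Y p + (k p / \<theta>) *\<^sub>R Z p" by (simp add: \<phi>_def g_def)
  show "\<forall>v. dder v \<psi> p + (k p / \<theta>) *\<^sub>R dder v Z p \<in> span {Y p, Z p}" using d_psi_d_Z[OF p] by blast
  show "d1 Z p \<notin> span {Y p, Z p}" by (rule d1_Z_notin_span[OF p])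
qed

lemma polar_frame_cong:
  assumes "polar_frame N W Y \<psi> c" "\<And>q. q \<in> W \<Longrightarrow> \<psi>' q = \<psi> q"
  shows "polar_frame N W Y \<psi>' c"
proof -
  interpret polar_frame N W Y \<psi> c by fact
  show ?thesis
  proof
    show "smooth_on W \<psi>'" using smooth_on_cong[OF open_W, of \<psi>' \<psi>] assms(2) smooth_psi by blast
    fix p assume p: "p \<in> W"
    show "\<psi>' p \<odot> \<psi>' p = c" "\<psi>' p \<in> V_perp N Y p" using psi_psi psi_perp assms(2) p by auto
    show "d1 \<psi>' p \<in> V_space Y p" "d2 \<psi>' p \<in> V_space Y p"
      using d_psi_V[OF p] dder_cong[OF open_W p assms(2)] by auto
  qed
qed

lemma polar_darboux_D_transform_on:
  fixes \<iota> :: "real ^ 'm::finite \<Rightarrow> real ^ 'k::finite"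
  assumes "\<theta> \<noteq> 0" and loc: "\<And>p. p \<in> D \<Longrightarrow> \<exists>W Y Z \<psi>. p \<in> W \<and> W \<subseteq> D \<and> polar_darboux N W Y Z \<theta> \<psi> c \<and>
      (\<forall>q\<in>W. sig_inner N (\<psi> q) (Z q) \<noteq> 0 \<and> \<psi>0 q = \<psi> q \<and>
        \<psi>s q = \<psi> q + sig_inner N (\<psi> q) (Z q) *\<^sub>R Y q + (sig_inner N (\<psi> q) (d1 (d1 Y) q) / \<theta>) *\<^sub>R Z q)"
    and lin: "linear \<iota>"
    and iso: "\<And>x y. sig_inner N' (\<iota> x) (\<iota> y) = sig_inner N x y"
    and orth: "\<And>x. sig_inner N' (\<iota> x) e = 0"
    and e: "sig_inner N' e e = - c"
  shows "D_transform_on N' D \<theta> (\<lambda>p. span {\<iota> (\<psi>0 p) + e}) (\<lambda>p. span {\<iota> (\<psi>s p) + e})"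
proof (rule D_transform_onI[OF assms(1)])
  fix p assume "p \<in> D"
  from loc[OF this] obtain W Y Z \<psi> where W: "p \<in> W" "W \<subseteq> D" "polar_darboux N W Y Z \<theta> \<psi> c"
    and eq: "\<forall>q\<in>W. sig_inner N (\<psi> q) (Z q) \<noteq> 0 \<and> \<psi>0 q = \<psi> q \<and>
        \<psi>s q = \<psi> q + sig_inner N (\<psi> q) (Z q) *\<^sub>R Y q + (sig_inner N (\<psi> q) (d1 (d1 Y) q) / \<theta>) *\<^sub>R Z q"
    by (elim exE conjE)
  interpret polar_darboux N W Y Z \<theta> \<psi> c by fact
  have g: "g q \<noteq> 0" if "q \<in> W" for q using eq that by (simp add: g_def)
  have sp: "span {t *\<^sub>R x} = span {x}" if "t \<noteq> 0" for t and x :: "real ^ 'k"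
    using real_vector.span_image_scale[of "{x}" "\<lambda>_. t"] that by simp
  have V: "\<forall>q\<in>W. span {\<iota> (\<psi>0 q) + e} = span {(1 / k q) *\<^sub>R (\<iota> (\<psi> q) + e)} \<and>
      span {\<iota> (\<psi>s q) + e} = span {(- \<theta> / g q) *\<^sub>R (\<iota> (\<phi> q) + e)}"
  proof
    fix q assume q: "q \<in> W"
    have "\<psi>0 q = \<psi> q" "\<psi>s q = \<phi> q" using eq q by (auto simp: \<phi>_def g_def k_def)
    then show "span {\<iota> (\<psi>0 q) + e} = span {(1 / k q) *\<^sub>R (\<iota> (\<psi> q) + e)} \<and>
      span {\<iota> (\<psi>s q) + e} = span {(- \<theta> / g q) *\<^sub>R (\<iota> (\<phi> q) + e)}"
      using g[OF q] k_nonzero[OF q] assms(1) sp[of "1 / k q"] sp[of "- \<theta> / g q"] by (metis divide_eq_0_iff neg_equal_0_iff_equal zero_neq_one)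
  qed
  note F = darboux_frame_phi[OF g lin iso orth e]
  show "\<exists>W Y Z. p \<in> W \<and> W \<subseteq> D \<and> darboux_frame N' W Y Z \<theta> \<and>
      (\<forall>q\<in>W. span {\<iota> (\<psi>0 q) + e} = span {Y q} \<and> span {\<iota> (\<psi>s q) + e} = span {Z q})"
    by (intro exI conjI, rule W(1), rule W(2), rule F, assumption, rule V)
qed

definition ext_embed :: "real ^ 'm::finite \<Rightarrow> real ^ 'm option" where
  "ext_embed x = (\<chi> i. case i of None \<Rightarrow> 0 | Some j \<Rightarrow> x $ j)"

definition ext_base :: "real \<Rightarrow> real ^ 'm::finite option" where
  "ext_base c = (\<chi> i. case i of None \<Rightarrow> sqrt \<bar>c\<bar> | Some j \<Rightarrow> 0)"

lemma ext_vec_eq: "ext_vec c x = ext_embed x + ext_base c"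
  by (simp add: ext_vec_def ext_embed_def ext_base_def vec_eq_iff split: option.split)

lemma linear_ext_embed: "linear ext_embed"
  by (rule linearI) (simp_all add: ext_embed_def vec_eq_iff split: option.split)

lemma sig_inner_ext_neg:
  "sig_inner (ext_neg N c) x y = (if c > 0 then -1 else 1) * (x $ None * y $ None) + sig_inner N (\<chi> i. x $ Some i) (\<chi> i. y $ Some i)"
  for x y :: "real ^ 'm::finite option"
  unfolding sig_inner_sum UNIV_option_conv
  by (auto simp: ext_neg_def sum.reindex image_iff intro!: sum.cong)

lemma polar_D_transform_onI:
  assumes "\<theta> \<noteq> 0" and loc: "\<And>p. p \<in> D \<Longrightarrow> \<exists>W Y Z \<psi>. p \<in> W \<and> W \<subseteq> D \<and> polar_darboux N W Y Z \<theta> \<psi> c \<and>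
      (\<forall>q\<in>W. sig_inner N (\<psi> q) (Z q) \<noteq> 0 \<and> \<psi>0 q = \<psi> q \<and>
        \<psi>s q = \<psi> q + sig_inner N (\<psi> q) (Z q) *\<^sub>R Y q + (sig_inner N (\<psi> q) (d1 (d1 Y) q) / \<theta>) *\<^sub>R Z q)"
  shows "polar_D_transform_on N D c \<theta> \<psi>0 \<psi>s"
proof (cases "c = 0")
  case True
  then show ?thesis
    using polar_darboux_D_transform_on[OF assms, where \<iota>="\<lambda>x. x" and N'=N and e=0]
    by (simp add: polar_D_transform_on_def linear_id[unfolded id_def] sig_inner_simps)
next
  case False
  have "D_transform_on (ext_neg N c) D \<theta> (\<lambda>p. span {ext_embed (\<psi>0 p) + ext_base c}) (\<lambda>p. span {ext_embed (\<psi>s p) + ext_base c})"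
  proof (rule polar_darboux_D_transform_on[OF assms linear_ext_embed])
    show "sig_inner (ext_neg N c) (ext_embed x) (ext_embed y) = sig_inner N x y" for x y
      by (simp add: sig_inner_ext_neg ext_embed_def)
    have z: "(\<chi> i. ext_base c $ Some i) = 0" by (simp add: ext_base_def vec_eq_iff)
    show "sig_inner (ext_neg N c) (ext_embed x) (ext_base c) = 0" for x
      unfolding sig_inner_ext_neg z by (simp add: ext_embed_def sig_inner_simps)
    show "sig_inner (ext_neg N c) (ext_base c) (ext_base c) = - c"
      unfolding sig_inner_ext_neg z using False by (simp add: ext_base_def sig_inner_simps)
  qed
  then show ?thesis using False by (simp add: polar_D_transform_on_def ext_vec_eq)
qed

theorem theorem4p2:
  fixes M :: "'a::topological_space set" and Z :: "'a atlas"
    and N :: "'m::finite set" and n r :: nat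
    and y ys :: "'a \<Rightarrow> (real ^ 'm) set" and \<psi> :: "'a \<Rightarrow> real ^ 'm"
    and \<theta> c :: real
  assumes "CARD('m) = n + 2" and "card N = r + 1" and "r + 2 \<le> n"
    and "complex_atlas M Z"
    and "isothermic N Z y"
    and "D_transform N Z \<theta> y ys"
    and "c_polar N Z c y \<psi>"
    and "nondegenerate N Z \<psi>"
  shows "\<exists>\<psi>s. c_polar N Z c ys \<psi>s \<and>
           polar_D_transform N (restrict_atlas Z (nonorthogonal_set N M \<psi> ys)) c \<theta> \<psi> \<psi>s"
proof -
  have M: "(\<Union>(U, z)\<in>Z. U) = M"
    and chart: "\<And>U z. (U, z) \<in> Z \<Longrightarrow> openin (top_of_set M) U \<and> open (z ` U) \<and>
        homeomorphism U (z ` U) z (inv_into U z)"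
    and hol: "\<And>U z U' z'. (U, z) \<in> Z \<Longrightarrow> (U', z') \<in> Z \<Longrightarrow>
        (\<lambda>w. z' (inv_into U z w)) holomorphic_on z ` (U \<inter> U')"
    using assms(4) unfolding complex_atlas_def by fast+
  have inv: "inv_into U z (z m) = m" if "(U, z) \<in> Z" "m \<in> U" for U z m
    using chart[OF that(1)] that(2) by (auto simp: homeomorphism_def)
  define val where "val U z m x \<longleftrightarrow> polar_value N (y \<circ> inv_into U z) (ys \<circ> inv_into U z) (\<psi> \<circ> inv_into U z) (z m) x"
    for U and z :: "'a \<Rightarrow> complex" and m x
  have val_unique: "x' = x" if c: "(U, z) \<in> Z" "(U', z') \<in> Z" and m: "m \<in> U" "m \<in> U'" and v: "val U z m x" "val U' z' m x'"
    for U z U' z' m x x'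
  proof -
    define T where "T = (\<lambda>w. z (inv_into U' z' w))"
    define V where "V = z' ` (U' \<inter> U)"
    have "openin (top_of_set U') (U' \<inter> U)"
      using chart[OF c(1)] chart[OF c(2)] by (meson openin_Int openin_imp_subset openin_subset_trans inf_le1)
    then have "openin (top_of_set (z' ` U')) V" unfolding V_def
      using homeomorphism_imp_open_map chart[OF c(2)] by blast
    then have V: "open V" using chart[OF c(2)] openin_open_eq by blast
    have p: "z' m \<in> V" using m by (auto simp: V_def)
    have h: "T holomorphic_on V" unfolding T_def V_def by (rule hol[OF c(2,1)])
    have Tm: "T (z' m) = z m" unfolding T_def using inv[OF c(2) m(2)] by simp
    show ?thesis
    proof (rule polar_value_unique[OF _ _ V p])
      show "polar_value N (y \<circ> inv_into U' z') (ys \<circ> inv_into U' z') (\<psi> \<circ> inv_into U' z') (z' m) x'"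
        using v(2) unfolding val_def .
      show "polar_value N (y \<circ> inv_into U z) (ys \<circ> inv_into U z) (\<psi> \<circ> inv_into U z) (T (z' m)) x"
        using v(1) unfolding val_def Tm .
      show "continuous_on V T" using h by (rule holomorphic_on_imp_continuous_on)
      show "T differentiable at (z' m)"
        using holomorphic_on_imp_differentiable_at[OF h V p] field_differentiable_imp_differentiable by blast
      fix q assume "q \<in> V"
      then obtain m' where m': "q = z' m'" "m' \<in> U'" "m' \<in> U" by (auto simp: V_def)
      then have "inv_into U z (T q) = inv_into U' z' q"
        unfolding T_def by (simp add: inv[OF c(1)] inv[OF c(2)])
      then show "(y \<circ> inv_into U' z') q = (y \<circ> inv_into U z) (T q) \<and> (ys \<circ> inv_into U' z') q = (ys \<circ> inv_into U z) (T q) \<and>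
        (\<psi> \<circ> inv_into U' z') q = (\<psi> \<circ> inv_into U z) (T q)" by simp
    qed
  qed
  define \<psi>s where "\<psi>s m = (SOME x. \<exists>U z. (U, z) \<in> Z \<and> m \<in> U \<and> val U z m x)" for m
  have psis: "\<psi>s m = x" if "(U, z) \<in> Z" "m \<in> U" "val U z m x" for U z m x
  proof -
    have "\<exists>x U z. (U, z) \<in> Z \<and> m \<in> U \<and> val U z m x" using that by blast
    from someI_ex[OF this] obtain U' z' where "(U', z') \<in> Z" "m \<in> U'" "val U' z' m (\<psi>s m)"
      unfolding \<psi>s_def by blast
    then show ?thesis using val_unique[OF that(1) _ that(2) _ that(3)] by blast
  qed
  have theta_nonzero: "\<theta> \<noteq> 0" if "(U, z) \<in> Z" for U z
    using assms(6) that unfolding D_transform_def D_transform_on_def by fast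
  have frames: "\<exists>W Y Zl. p \<in> W \<and> W \<subseteq> z ` U \<and> polar_darboux N W Y Zl \<theta> (\<psi> \<circ> inv_into U z) c \<and>
      (\<forall>q\<in>W. (ys \<circ> inv_into U z) q = span {Zl q} \<and>
        (\<psi>s \<circ> inv_into U z) q = polar_darboux.\<phi> N Y Zl \<theta> (\<psi> \<circ> inv_into U z) q)"
    if c: "(U, z) \<in> Z" and p: "p \<in> z ` U" for U z p
  proof -
    have "D_transform_on N (z ` U) \<theta> (y \<circ> inv_into U z) (ys \<circ> inv_into U z)"
      "c_polar_on N (z ` U) c (y \<circ> inv_into U z) (\<psi> \<circ> inv_into U z)"
      "nondegenerate_on N (z ` U) (\<psi> \<circ> inv_into U z)"
      using assms(6-8) c unfolding D_transform_def c_polar_def nondegenerate_def by fast+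
    then obtain W Y Zl where W: "p \<in> W" "W \<subseteq> z ` U" "polar_darboux N W Y Zl \<theta> (\<psi> \<circ> inv_into U z) c"
      and l: "\<And>q. q \<in> W \<Longrightarrow> (y \<circ> inv_into U z) q = span {Y q} \<and> (ys \<circ> inv_into U z) q = span {Zl q}"
      by (rule polar_darboux_ex[OF _ _ _ p]) (rule that)
    have "(\<psi>s \<circ> inv_into U z) q = polar_darboux.\<phi> N Y Zl \<theta> (\<psi> \<circ> inv_into U z) q" if q: "q \<in> W" for q
    proof -
      obtain m where m: "q = z m" "m \<in> U" using q W(2) by blast
      have "val U z m (polar_darboux.\<phi> N Y Zl \<theta> (\<psi> \<circ> inv_into U z) q)"
        unfolding val_def m(1)[symmetric] by (rule polar_darboux.polar_value_phi[OF W(3) q l])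
      from psis[OF c m(2) this] show ?thesis by (simp add: m inv[OF c])
    qed
    then have "\<forall>q\<in>W. (ys \<circ> inv_into U z) q = span {Zl q} \<and>
        (\<psi>s \<circ> inv_into U z) q = polar_darboux.\<phi> N Y Zl \<theta> (\<psi> \<circ> inv_into U z) q" using l by simp
    note V = this
    show ?thesis by (intro exI conjI, rule W(1), rule W(2), rule W(3), rule V)
  qed
  have "c_polar N Z c ys \<psi>s" unfolding c_polar_def
  proof (clarify, rule c_polar_onI)
    fix U z p assume c: "(U, z) \<in> Z" and p: "p \<in> z ` U"
    from frames[OF this] obtain W Y Zl where W: "p \<in> W" "W \<subseteq> z ` U" "polar_darboux N W Y Zl \<theta> (\<psi> \<circ> inv_into U z) c"
      and l: "\<forall>q\<in>W. (ys \<circ> inv_into U z) q = span {Zl q} \<and>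
        (\<psi>s \<circ> inv_into U z) q = polar_darboux.\<phi> N Y Zl \<theta> (\<psi> \<circ> inv_into U z) q"
      by (elim exE conjE)
    interpret polar_darboux N W Y Zl \<theta> "\<psi> \<circ> inv_into U z" c by fact
    have F: "polar_frame N W (\<lambda>p. (1 / \<bar>\<theta>\<bar>) *\<^sub>R Zl p) (\<psi>s \<circ> inv_into U z) c"
      by (rule polar_frame_cong[OF polar_frame_phi]) (use l in blast)
    have nz: "(\<psi>s \<circ> inv_into U z) p \<noteq> 0" using phi_nonzero[OF W(1)] l W(1) by simp
    have "span {Zl q} = span {(1 / \<bar>\<theta>\<bar>) *\<^sub>R Zl q}" for q
      using real_vector.span_image_scale[of "{Zl q}" "\<lambda>_. 1 / \<bar>\<theta>\<bar>"] theta_nonzero[OF c] by simp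
    then have V: "\<forall>q\<in>W. (ys \<circ> inv_into U z) q = span {(1 / \<bar>\<theta>\<bar>) *\<^sub>R Zl q}" using l by simp
    show "\<exists>W Y. p \<in> W \<and> W \<subseteq> z ` U \<and> polar_frame N W Y (\<psi>s \<circ> inv_into U z) c \<and> (\<psi>s \<circ> inv_into U z) p \<noteq> 0 \<and>
        (\<forall>q\<in>W. (ys \<circ> inv_into U z) q = span {Y q})"
      by (intro exI conjI, rule W(1), rule W(2), rule F, rule nz, rule V)
  qed
  moreover have "polar_D_transform N (restrict_atlas Z (nonorthogonal_set N M \<psi> ys)) c \<theta> \<psi> \<psi>s"
    unfolding polar_D_transform_def restrict_atlas_def
  proof clarify
    fix U z assume c: "(U, z) \<in> Z"
    define A where "A = nonorthogonal_set N M \<psi> ys"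
    have inv_A: "inv_into (U \<inter> A) z (z m) = m" if "m \<in> U" "m \<in> A" for m
    proof -
      have "inj_on z U" using inv[OF c] by (metis inj_onI)
      then show ?thesis using that by (simp add: inj_on_Int inv_into_f_f)
    qed
    show "polar_D_transform_on N (z ` (U \<inter> A)) c \<theta> (\<psi> \<circ> inv_into (U \<inter> A) z) (\<psi>s \<circ> inv_into (U \<inter> A) z)"
    proof (rule polar_D_transform_onI[OF theta_nonzero[OF c]])
      fix p assume p: "p \<in> z ` (U \<inter> A)"
      then have "p \<in> z ` U" by blast
      from frames[OF c this] obtain W Y Zl where W: "p \<in> W" "W \<subseteq> z ` U" "polar_darboux N W Y Zl \<theta> (\<psi> \<circ> inv_into U z) c"
        and l: "\<forall>q\<in>W. (ys \<circ> inv_into U z) q = span {Zl q} \<and>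
          (\<psi>s \<circ> inv_into U z) q = polar_darboux.\<phi> N Y Zl \<theta> (\<psi> \<circ> inv_into U z) q"
        by (elim exE conjE)
      interpret polar_darboux N W Y Zl \<theta> "\<psi> \<circ> inv_into U z" c by fact
      define W' where "W' = {q \<in> W. g q \<noteq> 0}"
      have W': "open W'" "W' \<subseteq> W"
        using continuous_open_preimage[OF smooth_on_continuous[OF smooth_g] open_W, of "- {0}"]
        by (auto simp: W'_def vimage_def Int_def open_Compl)
      have A_iff: "m \<in> A \<longleftrightarrow> g (z m) \<noteq> 0" if m: "m \<in> U" "z m \<in> W" for m
      proof -
        have "m \<in> M" using M c m by blast
        moreover have "ys m = span {Zl (z m)}" using l m(2) inv[OF c m(1)] by force
        ultimately show ?thesis
          by (auto simp: A_def nonorthogonal_set_def g_def inv[OF c m(1)] span_singleton sig_inner_simps)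
      qed
      have W'A: "W' \<subseteq> z ` (U \<inter> A)" using W(2) A_iff by (auto simp: W'_def)
      have pW': "p \<in> W'" using p W(1) A_iff by (auto simp: W'_def)
      have V: "\<forall>q\<in>W'. sig_inner N ((\<psi> \<circ> inv_into U z) q) (Zl q) \<noteq> 0 \<and>
          (\<psi> \<circ> inv_into (U \<inter> A) z) q = (\<psi> \<circ> inv_into U z) q \<and>
          (\<psi>s \<circ> inv_into (U \<inter> A) z) q = (\<psi> \<circ> inv_into U z) q + sig_inner N ((\<psi> \<circ> inv_into U z) q) (Zl q) *\<^sub>R Y q
            + (sig_inner N ((\<psi> \<circ> inv_into U z) q) (d1 (d1 Y) q) / \<theta>) *\<^sub>R Zl q"
      proof
        fix q assume q: "q \<in> W'"
        obtain m where m: "q = z m" "m \<in> U" "m \<in> A" using W'A q by blast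
        have i: "inv_into (U \<inter> A) z q = inv_into U z q" using m inv_A inv[OF c] by simp
        have "(\<psi>s \<circ> inv_into U z) q = \<phi> q" using l q W'(2) by blast
        then show "sig_inner N ((\<psi> \<circ> inv_into U z) q) (Zl q) \<noteq> 0 \<and>
          (\<psi> \<circ> inv_into (U \<inter> A) z) q = (\<psi> \<circ> inv_into U z) q \<and>
          (\<psi>s \<circ> inv_into (U \<inter> A) z) q = (\<psi> \<circ> inv_into U z) q + sig_inner N ((\<psi> \<circ> inv_into U z) q) (Zl q) *\<^sub>R Y q
            + (sig_inner N ((\<psi> \<circ> inv_into U z) q) (d1 (d1 Y) q) / \<theta>) *\<^sub>R Zl q"
          using q i by (simp add: W'_def \<phi>_def g_def k_def)
      qed
      show "\<exists>W Y Z \<psi>'. p \<in> W \<and> W \<subseteq> z ` (U \<inter> A) \<and> polar_darboux N W Y Z \<theta> \<psi>' c \<and>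
        (\<forall>q\<in>W. sig_inner N (\<psi>' q) (Z q) \<noteq> 0 \<and> (\<psi> \<circ> inv_into (U \<inter> A) z) q = \<psi>' q \<and>
          (\<psi>s \<circ> inv_into (U \<inter> A) z) q = \<psi>' q + sig_inner N (\<psi>' q) (Z q) *\<^sub>R Y q
            + (sig_inner N (\<psi>' q) (d1 (d1 Y) q) / \<theta>) *\<^sub>R Z q)"
        by (intro exI conjI, rule pW', rule W'A, rule polar_darboux_subset[OF W(3) W'], rule V)
    qed
  qed
  ultimately show ?thesis by blast
qed

end
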